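(* Fix integers $r\ge 1$ and $t\ge 2$. Let $F$ be a graph without isolated vertices such that every edge of $F$ belongs to a copy of $K_t$ in $F$, and suppose that $sat(n,F)<(t-1)n-\binom{t}{2}-2$ for all sufficiently large $n$. Then for all sufficiently large $n$, $$sat(n,K_r\vee F)=r(n-r)+sat(n-r,F)+\binom{r}{2}.$$ Moreover, for all sufficiently large $n$, every extremal graph $G$ for $sat(n,K_r\vee F)$ (that is, every $(K_r\vee F)$-saturated graph on $n$ vertices with exactly $sat(n,K_r\vee F)$ edges) contains $r$ conical vertices.
   Context: All graphs are finite and simple. A graph $G$ is $F$-saturated if $G$ contains no copy of $F$ and, for every nonedge $e$ of $G$, the graph $G+e$ contains a copy of $F$. $sat(n,F)$ is the minimum number of edges of an $F$-saturated graph on $n$ vertices. The join $G_1\vee G_2$ is obtained from the vertex-disjoint union of $G_1$ and $G_2$ by adding all edges between $V(G_1)$ and $V(G_2)$. A vertex of an $n$-vertex graph is conical if its degree is $n-1$. *)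

theory Defs
  imports Complex_Main
begin

text \<open>A graph is a pair of a vertex set and a set of two-element edges.\<close>

type_synonym 'a ugraph = "'a set \<times> 'a set set"

abbreviation uverts :: "'a ugraph \<Rightarrow> 'a set" where
  "uverts G \<equiv> fst G"

abbreviation uedges :: "'a ugraph \<Rightarrow> 'a set set" where
  "uedges G \<equiv> snd G"

definition simple_graph :: "'a ugraph \<Rightarrow> bool" where
  "simple_graph G \<longleftrightarrow> finite (uverts G) \<and> (\<forall>e\<in>uedges G. e \<subseteq> uverts G \<and> card e = 2)"

definition subgraph :: "'a ugraph \<Rightarrow> 'a ugraph \<Rightarrow> bool" where
  "subgraph H G \<longleftrightarrow> simple_graph H \<and> uverts H \<subseteq> uverts G \<and> uedges H \<subseteq> uedges G"

definition isomorphic :: "'a ugraph \<Rightarrow> 'b ugraph \<Rightarrow> bool" where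
  "isomorphic G H \<longleftrightarrow>
     (\<exists>f. bij_betw f (uverts G) (uverts H) \<and> uedges H = (\<lambda>e. f ` e) ` uedges G)"

text \<open>Copies are subgraphs that need not be induced.\<close>

definition copy_in :: "'b ugraph \<Rightarrow> 'a ugraph \<Rightarrow> 'b ugraph \<Rightarrow> bool" where
  "copy_in H F G \<longleftrightarrow> subgraph H G \<and> isomorphic F H"

definition contains_copy :: "'b ugraph \<Rightarrow> 'a ugraph \<Rightarrow> bool" where
  "contains_copy G F \<longleftrightarrow> (\<exists>H. copy_in H F G)"

definition add_edge :: "'a ugraph \<Rightarrow> 'a set \<Rightarrow> 'a ugraph" where
  "add_edge G e = (uverts G, insert e (uedges G))"

definition nonedges :: "'a ugraph \<Rightarrow> 'a set set" where
  "nonedges G = {e. e \<subseteq> uverts G \<and> card e = 2 \<and> e \<notin> uedges G}"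

definition saturated :: "'a ugraph \<Rightarrow> 'b ugraph \<Rightarrow> bool" where
  "saturated F G \<longleftrightarrow> simple_graph G \<and> \<not> contains_copy G F \<and>
     (\<forall>e\<in>nonedges G. contains_copy (add_edge G e) F)"

text \<open>Every finite graph is isomorphic to one with vertices in \<open>nat\<close>, so the minimum may be
  taken over those. It is attained whenever \<open>F\<close> has at least one edge; if \<open>F\<close> is the graph
  without vertices, there is no \<open>F\<close>-saturated graph and the value is meaningless.\<close>

definition sat :: "nat \<Rightarrow> 'a ugraph \<Rightarrow> nat" where
  "sat n F = (LEAST m. \<exists>G :: nat ugraph.
     saturated F G \<and> card (uverts G) = n \<and> card (uedges G) = m)"

definition complete_graph :: "nat \<Rightarrow> nat ugraph" where
  "complete_graph n = ({..<n}, {e. e \<subseteq> {..<n} \<and> card e = 2})"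

definition join :: "'a ugraph \<Rightarrow> 'b ugraph \<Rightarrow> ('a + 'b) ugraph" where
  "join G H =
     (uverts G <+> uverts H,
      (\<lambda>e. Inl ` e) ` uedges G \<union> (\<lambda>e. Inr ` e) ` uedges H \<union>
      {{Inl u, Inr v} | u v. u \<in> uverts G \<and> v \<in> uverts H})"

definition degree :: "'a ugraph \<Rightarrow> 'a \<Rightarrow> nat" where
  "degree G v = card {e \<in> uedges G. v \<in> e}"

definition conical :: "'a ugraph \<Rightarrow> 'a \<Rightarrow> bool" where
  "conical G v \<longleftrightarrow> v \<in> uverts G \<and> degree G v = card (uverts G) - 1"

definition extremal :: "nat \<Rightarrow> 'a ugraph \<Rightarrow> 'b ugraph \<Rightarrow> bool" where
  "extremal n F G \<longleftrightarrow> saturated F G \<and> card (uverts G) = n \<and> card (uedges G) = sat n F"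

end

theory Submission
  imports Defs
begin

text \<open>
  Write \<open>P\<close> for the join of \<open>K_r\<close> and \<open>F\<close>. Deleting a cone, that is, a vertex adjacent to all others,
  from both pattern and host preserves saturation in both directions (\<open>saturated_del_cone\<close>). Joining
  \<open>K_r\<close> to a smallest \<open>F\<close>-saturated graph hence gives the upper bound on \<open>sat n P\<close>. For the lower
  bound and the conical vertices it suffices to find a single cone in every large \<open>P\<close>-saturated graph
  with few edges, since one can then delete it and use induction on \<open>r\<close>. The assumed bound on
  \<open>sat n F\<close> is of the form preserved by such a step: each cone adds \<open>n - 1\<close> edges, and
  \<open>(k - 1) * n - (k choose 2) - 2\<close> grows by exactly this amount when \<open>k\<close> and the number of vertices
  increase by one.

  Let \<open>k = t + r\<close> and \<open>T = k - 1\<close>. Every edge of \<open>P\<close> lies in a \<open>K_k\<close>, so any two non-adjacent vertices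
  of a \<open>P\<close>-saturated graph have \<open>T - 1\<close> common neighbours that form a clique. The core of the proof is
  that a large graph with this property and fewer than \<open>T * n - (T + 1 choose 2) - 2\<close> edges has a
  cone (\<open>cone_if_few_edges\<close>). The argument looks at the distribution of edges around a vertex \<open>v\<close> of
  small degree, and depends on that degree:

  \<^item> Below \<open>T\<close>, all neighbours of \<open>v\<close> are cones (\<open>cone_of_degree_small\<close>).

  \<^item> For degree \<open>T\<close>, an exact count of edges shows that a graph without a cone has too many of
    them (\<open>edges_if_degree_t\<close>).

  \<^item> If all degrees exceed \<open>T\<close>, a discharging argument shows that almost all vertices far from \<open>v\<close> are
    adjacent to the same \<open>T - 1\<close> neighbours of \<open>v\<close>, and these are cones
    (\<open>cone_if_min_degree_gt_t\<close>).
\<close>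

section \<open>Counting edges\<close>

locale fin_graph =
  fixes V :: "'b set" and E :: "'b set set"
  assumes finV: "finite V" and edgeD: "e \<in> E \<Longrightarrow> e \<subseteq> V \<and> card e = 2"
begin

definition nbrs :: "'b \<Rightarrow> 'b set" where
  "nbrs u = {w. {u, w} \<in> E}"

definition induced_edges :: "'b set \<Rightarrow> 'b set set" where
  "induced_edges A = {e \<in> E. e \<subseteq> A}"

lemma nbrs_sym: "u \<in> nbrs w \<longleftrightarrow> w \<in> nbrs u"
  by (simp add: nbrs_def insert_commute)

lemma nbrs_irrefl: "u \<notin> nbrs u"
  using edgeD[of "{u, u}"] by (auto simp: nbrs_def)

lemma nbrs_subset: "nbrs u \<subseteq> V"
  using edgeD by (auto simp: nbrs_def)

lemma finite_nbrs: "finite (nbrs u)"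
  using nbrs_subset finV finite_subset by blast

lemma finite_edges: "finite E"
proof -
  have "E \<subseteq> Pow V" using edgeD by auto
  then show ?thesis using finV by (simp add: finite_subset)
qed

lemma finite_induced_edges: "finite (induced_edges A)"
  unfolding induced_edges_def using finite_edges by simp

lemma induced_edges_V: "induced_edges V = E"
  using edgeD by (auto simp: induced_edges_def)

text \<open>Edge sets are counted by adding the vertices one at a time.\<close>

lemma card_induced_edges_insert:
  assumes "finite A" "c \<notin> A"
  shows "card (induced_edges (insert c A)) = card (induced_edges A) + card (nbrs c \<inter> A)"
proof -
  have split: "induced_edges (insert c A) = induced_edges A \<union> (\<lambda>w. {c, w}) ` (nbrs c \<inter> A)"
  proof (intro set_eqI iffI)
    fix e assume e: "e \<in> induced_edges (insert c A)"
    show "e \<in> induced_edges A \<union> (\<lambda>w. {c, w}) ` (nbrs c \<inter> A)"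
    proof (cases "c \<in> e")
      case True
      from e have "card e = 2" using edgeD by (auto simp: induced_edges_def)
      with True obtain w where w: "e = {c, w}" "w \<noteq> c"
        by (auto simp: card_2_iff)
      with e have "w \<in> nbrs c \<inter> A" by (auto simp: induced_edges_def nbrs_def)
      with w show ?thesis by blast
    next
      case False
      with e show ?thesis by (auto simp: induced_edges_def)
    qed
  next
    fix e assume "e \<in> induced_edges A \<union> (\<lambda>w. {c, w}) ` (nbrs c \<inter> A)"
    then show "e \<in> induced_edges (insert c A)" by (auto simp: induced_edges_def nbrs_def)
  qed
  have disj: "induced_edges A \<inter> (\<lambda>w. {c, w}) ` (nbrs c \<inter> A) = {}"
    using assms(2) by (auto simp: induced_edges_def)
  have inj: "inj_on (\<lambda>w. {c, w}) (nbrs c \<inter> A)"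
    using assms(2) by (auto simp: inj_on_def doubleton_eq_iff)
  show ?thesis
    unfolding split using disj inj finite_induced_edges assms(1)
    by (simp add: card_Un_disjoint card_image)
qed

lemma card_induced_edges_Un:
  assumes "finite A" "finite C" "A \<inter> C = {}"
  shows "card (induced_edges (A \<union> C)) =
    card (induced_edges A) + card (induced_edges C) + (\<Sum>c\<in>C. card (nbrs c \<inter> A))"
  using assms(2,3)
proof (induction C rule: finite_induct)
  case empty
  have "induced_edges {} = {}" using edgeD by (fastforce simp: induced_edges_def)
  then show ?case by simp
next
  case (insert c C)
  have "card (induced_edges (A \<union> insert c C)) = card (induced_edges (A \<union> C)) + card (nbrs c \<inter> (A \<union> C))"
    using card_induced_edges_insert[of "A \<union> C" c] insert assms(1) by simp
  moreover have "card (nbrs c \<inter> (A \<union> C)) = card (nbrs c \<inter> A) + card (nbrs c \<inter> C)"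
    using insert assms(1) finite_nbrs
    by (subst card_Un_disjoint[symmetric]) (auto simp: Int_Un_distrib)
  moreover have "card (induced_edges (insert c C)) = card (induced_edges C) + card (nbrs c \<inter> C)"
    using card_induced_edges_insert[of C c] insert by simp
  ultimately show ?case using insert by simp
qed

lemma handshake:
  assumes "finite A"
  shows "(\<Sum>a\<in>A. card (nbrs a \<inter> A)) = 2 * card (induced_edges A)"
  using assms
proof (induction A rule: finite_induct)
  case empty
  have "induced_edges {} = {}" using edgeD by (fastforce simp: induced_edges_def)
  then show ?case by simp
next
  case (insert c A)
  have c: "nbrs c \<inter> insert c A = nbrs c \<inter> A" using nbrs_irrefl by auto
  have a: "card (nbrs a \<inter> insert c A) = card (nbrs a \<inter> A) + (if a \<in> nbrs c then 1 else 0)" for a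
  proof (cases "a \<in> nbrs c")
    case True
    then have "nbrs a \<inter> insert c A = insert c (nbrs a \<inter> A)" using nbrs_sym by auto
    then show ?thesis using True insert by simp
  next
    case False
    then have "nbrs a \<inter> insert c A = nbrs a \<inter> A" using nbrs_sym by auto
    then show ?thesis using False by simp
  qed
  have "(\<Sum>a\<in>A. (if a \<in> nbrs c then 1 else 0 :: nat)) = card (nbrs c \<inter> A)"
    using insert by (simp add: sum.If_cases Int_commute)
  then show ?case
    using insert card_induced_edges_insert[of A c] nbrs_irrefl by (simp add: c a sum.distrib)
qed

text \<open>This stands in for spanning trees of components. A largest set that contains \<open>y\<close> and has at
  most one vertex more than induced edges is a union of components, because an edge leaving it would
  allow it to grow.\<close>

lemma closed_set_few_vertices:
  assumes "finite B" "y \<in> B"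
  obtains S where "y \<in> S" "S \<subseteq> B" "card S \<le> card (induced_edges S) + 1"
    "\<And>s b. s \<in> S \<Longrightarrow> b \<in> B - S \<Longrightarrow> b \<notin> nbrs s"
proof -
  define \<S> where "\<S> = {S. y \<in> S \<and> S \<subseteq> B \<and> card S \<le> card (induced_edges S) + 1}"
  have "finite \<S>" using assms(1) by (auto simp: \<S>_def intro: finite_subset[of _ "Pow B"])
  moreover have "{y} \<in> \<S>" using assms(2) by (simp add: \<S>_def)
  ultimately obtain S where S: "S \<in> \<S>" and mx: "\<And>T. T \<in> \<S> \<Longrightarrow> card T \<le> card S"
    using Max_in[of "card ` \<S>"] Max_ge[of "card ` \<S>"]
    by (metis (no_types, lifting) empty_iff finite_imageI imageE image_eqI)
  have finS: "finite S" using S assms(1) finite_subset by (auto simp: \<S>_def)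
  show thesis
  proof (rule that)
    fix s b assume sb: "s \<in> S" "b \<in> B - S"
    show "b \<notin> nbrs s"
    proof
      assume "b \<in> nbrs s"
      then have "s \<in> nbrs b \<inter> S" using sb nbrs_sym by auto
      then have "card (nbrs b \<inter> S) \<ge> 1" using finS
        by (metis card_gt_0_iff empty_iff finite_Int less_eq_Suc_le One_nat_def)
      then have "insert b S \<in> \<S>"
        using S sb card_induced_edges_insert[OF finS, of b] finS by (auto simp: \<S>_def)
      from mx[OF this] show False using sb finS by simp
    qed
  qed (use S in \<open>auto simp: \<S>_def\<close>)
qed

end

section \<open>Graphs in which non-adjacent vertices share a clique\<close>

text \<open>A crude bound. Here \<open>m\<close> bounds the degrees inside the part of the graph far from a vertex of small
  degree, and \<open>l\<close> bounds the number of exceptional vertices of that part.\<close>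

definition cone_threshold :: "nat \<Rightarrow> nat" where
  "cone_threshold t = (let m = 4 * t * t + 1; l = m * m + 2 * m in 2 * t + 2 + 2 * l + l * m)"

text \<open>What saturation leaves behind: if every edge of a pattern lies in a clique of size \<open>t + 1\<close>,
  then joining two non-adjacent vertices of a saturated graph creates such a clique through them,
  whose other \<open>t - 1\<close> vertices are common neighbours.\<close>

locale linked_graph = fin_graph +
  fixes t :: nat
  assumes t2: "2 \<le> t"
    and linked: "\<lbrakk>u \<in> V; w \<in> V; u \<noteq> w; w \<notin> nbrs u\<rbrakk> \<Longrightarrow>
      \<exists>Q. Q \<subseteq> nbrs u \<inter> nbrs w \<and> card Q = t - 1 \<and> (\<forall>x\<in>Q. \<forall>y\<in>Q. x \<noteq> y \<longrightarrow> y \<in> nbrs x)"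
begin

lemma card_common_nbrs:
  assumes "u \<in> V" "w \<in> V" "u \<noteq> w" "w \<notin> nbrs u"
  shows "t - 1 \<le> card (nbrs u \<inter> nbrs w)"
  using linked[OF assms] finite_nbrs by (metis card_mono finite_Int)

lemma edge_count:
  assumes "v \<in> V" and "B = V - insert v (nbrs v)"
  shows "card E = card (nbrs v) + card (induced_edges (nbrs v)) + card (induced_edges B) +
    (\<Sum>b\<in>B. card (nbrs b \<inter> nbrs v))"
proof -
  have V: "V = insert v (nbrs v) \<union> B" using assms nbrs_subset by auto
  have "nbrs b \<inter> insert v (nbrs v) = nbrs b \<inter> nbrs v" if "b \<in> B" for b
    using that assms nbrs_sym by auto
  moreover have "card E = card (induced_edges (insert v (nbrs v) \<union> B))" using V induced_edges_V by simp
  ultimately show ?thesis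
    using card_induced_edges_Un[of "insert v (nbrs v)" B] card_induced_edges_insert[of "nbrs v" v] nbrs_irrefl finite_nbrs finV
    by (simp add: assms(2) Int_absorb)
qed

lemma vertex_count:
  assumes "v \<in> V" and "B = V - insert v (nbrs v)"
  shows "card V = card B + card (nbrs v) + 1"
proof -
  have "card V = card (insert v (nbrs v) \<union> B)"
    by (rule arg_cong[where f = card]) (use assms nbrs_subset in auto)
  also have "\<dots> = card (insert v (nbrs v)) + card B"
    using assms finV finite_nbrs by (intro card_Un_disjoint) auto
  finally show ?thesis using nbrs_irrefl finite_nbrs by simp
qed

text \<open>The clique shared by \<open>v\<close> and a non-neighbour of \<open>v\<close> has at least as many vertices as \<open>v\<close> has
  neighbours, so it is the whole neighbourhood of \<open>v\<close>.\<close>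

lemma cone_of_degree_small:
  assumes "v \<in> V" "card (nbrs v) < t" "t < card V" "x \<in> nbrs v" "w \<in> V" "w \<noteq> x"
  shows "w \<in> nbrs x"
proof -
  have eq: "nbrs v \<subseteq> nbrs b \<and> (\<forall>x\<in>nbrs v. \<forall>y\<in>nbrs v. x \<noteq> y \<longrightarrow> y \<in> nbrs x)"
    if b: "b \<in> V - insert v (nbrs v)" for b
  proof -
    obtain Q where Q: "Q \<subseteq> nbrs v \<inter> nbrs b" "card Q = t - 1"
      "\<forall>x\<in>Q. \<forall>y\<in>Q. x \<noteq> y \<longrightarrow> y \<in> nbrs x"
      using linked[of v b] b assms(1) by auto
    have "Q = nbrs v"
      using Q assms(2) finite_nbrs by (intro card_seteq) auto
    then show ?thesis using Q by auto
  qed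
  have "V - insert v (nbrs v) \<noteq> {}"
    using vertex_count[OF assms(1) refl] assms(2,3) by fastforce
  then obtain b where "b \<in> V - insert v (nbrs v)" by blast
  then show ?thesis using eq[of b] eq[of w] assms nbrs_sym by blast
qed

text \<open>Let \<open>D\<close> be the neighbourhood of \<open>v\<close>, let \<open>B\<close> consist of the vertices that are neither \<open>v\<close> nor in \<open>D\<close>,
  and let \<open>Y\<close> be the vertices of \<open>B\<close> that are not adjacent to all of \<open>D\<close>. Each of them misses
  exactly one vertex of \<open>D\<close>, and the non-adjacent pairs in \<open>D\<close> all go through one vertex \<open>x\<close>; let
  \<open>M\<close> be the set of their other ends. Counting edges at \<open>v\<close>, inside \<open>D\<close>, between \<open>D\<close> and \<open>B\<close>, and inside
  \<open>B\<close>, the claim becomes \<open>card Y + card M \<le> e(B) + 2\<close>, where \<open>e(B)\<close> is the number of edges inside \<open>B\<close>.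

  If \<open>Y\<close> lies in one component of \<open>B\<close>, then \<open>card Y \<le> e(B) + 1\<close>. Otherwise all vertices of \<open>Y\<close> miss the
  same vertex of \<open>D\<close>, since vertices missing different ones would be too short of common neighbours.
  That is impossible if \<open>D\<close> is a clique, as no vertex of \<open>D\<close> is a cone. If \<open>D\<close> is not a clique, it
  gives every vertex of \<open>Y\<close> a neighbour in \<open>B\<close> outside \<open>Y\<close>, hence an edge of its own;
  a large \<open>M\<close> is paid for by edges of the clique shared by a non-adjacent pair in \<open>D\<close>.

  For \<open>t = 2\<close> the 5-cycle attains equality.\<close>

lemma edges_if_degree_t:
  assumes v: "v \<in> V" "card (nbrs v) = t" and n: "t + 1 < card V"
    and no_cone: "\<And>c. c \<in> V \<Longrightarrow> \<exists>w\<in>V. w \<noteq> c \<and> w \<notin> nbrs c"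
  shows "t * card V \<le> card E + (Suc t choose 2) + 2"
proof -
  define D where "D = nbrs v"
  define B where "B = V - insert v D"
  define Y where "Y = {b \<in> B. \<not> D \<subseteq> nbrs b}"
  have finD: "finite D" and finB: "finite B" and finY: "finite Y"
    using finite_nbrs finV by (auto simp: D_def B_def Y_def)
  have cardD: "card D = t" using v D_def by simp
  have DV: "D \<subseteq> V" using nbrs_subset D_def by simp
  have vnb: "b \<in> B \<Longrightarrow> v \<notin> nbrs b" for b using nbrs_sym by (auto simp: B_def D_def)
  have nbsplit: "nbrs x \<subseteq> insert v (D \<union> B)" for x using nbrs_subset[of x] by (auto simp: B_def)
  have miss: "\<exists>x\<in>D. D - {x} \<subseteq> nbrs b \<and> (\<forall>p\<in>D-{x}. \<forall>q\<in>D-{x}. p \<noteq> q \<longrightarrow> q \<in> nbrs p)"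
    if b: "b \<in> B" for b
  proof -
    obtain Q where Q: "Q \<subseteq> D \<inter> nbrs b" "card Q = t - 1"
      "\<forall>x\<in>Q. \<forall>y\<in>Q. x \<noteq> y \<longrightarrow> y \<in> nbrs x"
      using linked[of v b] b v by (auto simp: B_def D_def)
    have "card (D - Q) = 1" using Q cardD t2 finD
      by (subst card_Diff_subset) (auto intro: finite_subset)
    then obtain x where x: "D - Q = {x}" by (auto simp: card_1_singleton_iff)
    then have "D - {x} = Q" "x \<in> D" using Q by auto
    then show ?thesis using Q by auto
  qed
  have "\<forall>y\<in>Y. \<exists>x. x \<in> D \<and> x \<notin> nbrs y \<and> D - {x} \<subseteq> nbrs y \<and>
      (\<forall>p\<in>D-{x}. \<forall>q\<in>D-{x}. p \<noteq> q \<longrightarrow> q \<in> nbrs p)"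
  proof
    fix y assume y: "y \<in> Y"
    then obtain x where x: "x \<in> D" "D - {x} \<subseteq> nbrs y"
      "\<forall>p\<in>D-{x}. \<forall>q\<in>D-{x}. p \<noteq> q \<longrightarrow> q \<in> nbrs p"
      using miss[of y] by (auto simp: Y_def)
    then have "x \<notin> nbrs y" using y by (auto simp: Y_def)
    with x show "\<exists>x. x \<in> D \<and> x \<notin> nbrs y \<and> D - {x} \<subseteq> nbrs y \<and>
      (\<forall>p\<in>D-{x}. \<forall>q\<in>D-{x}. p \<noteq> q \<longrightarrow> q \<in> nbrs p)" by blast
  qed
  then obtain ix where ixD: "\<And>y. y \<in> Y \<Longrightarrow> ix y \<in> D"
    and ixn: "\<And>y. y \<in> Y \<Longrightarrow> ix y \<notin> nbrs y"
    and ixa: "\<And>y. y \<in> Y \<Longrightarrow> D - {ix y} \<subseteq> nbrs y"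
    and ixc: "\<And>y p q. \<lbrakk>y \<in> Y; p \<in> D - {ix y}; q \<in> D - {ix y}; p \<noteq> q\<rbrakk> \<Longrightarrow> q \<in> nbrs p"
    unfolding bchoice_iff by blast
  have dcount: "(\<Sum>b\<in>B. card (nbrs b \<inter> D)) + card Y = t * card B"
  proof -
    have "card (nbrs b \<inter> D) + (if b \<in> Y then 1 else 0) = t" if b: "b \<in> B" for b
    proof (cases "b \<in> Y")
      case True
      have "nbrs b \<inter> D = D - {ix b}" using ixa[OF True] ixn[OF True] by auto
      then show ?thesis using True ixD[OF True] cardD finD t2 by simp
    next
      case False
      then have "nbrs b \<inter> D = D" using b by (auto simp: Y_def)
      then show ?thesis using False cardD by simp
    qed
    then have "(\<Sum>b\<in>B. card (nbrs b \<inter> D) + (if b \<in> Y then 1 else 0)) = (\<Sum>b\<in>B. t)"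
      by (intro sum.cong) auto
    moreover have "(\<Sum>b\<in>B. if b \<in> Y then 1 else 0 :: nat) = card Y"
    proof -
      have "B \<inter> Y = Y" by (auto simp: Y_def)
      then show ?thesis using finB by (simp add: sum.If_cases)
    qed
    ultimately show ?thesis by (simp add: sum.distrib mult.commute)
  qed
  have cardV: "card V = card B + t + 1"
    using vertex_count[of v B] v by (simp add: B_def D_def)
  have cardE: "card E = t + card (induced_edges D) + card (induced_edges B) + (\<Sum>b\<in>B. card (nbrs b \<inter> D))"
    using edge_count[of v B] v by (simp add: B_def D_def)

  \<comment> \<open>Vertices of \<open>Y\<close> that miss different neighbours of \<open>v\<close> are adjacent or share a neighbour
    in \<open>B\<close>, as they share only \<open>t - 2\<close> neighbours in \<open>D\<close>.\<close>
  have ix_eq: "ix y = ix z"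
    if yz: "y \<in> Y" "z \<in> Y" "z \<noteq> y" "z \<notin> nbrs y" "nbrs y \<inter> nbrs z \<inter> B = {}" for y z
  proof (rule ccontr)
    assume ne: "ix y \<noteq> ix z"
    have "nbrs y \<inter> nbrs z \<subseteq> D - {ix y, ix z}"
      using yz(5) ixn[OF yz(1)] ixn[OF yz(2)] nbsplit[of y] vnb[of y] yz(1) by (auto simp: Y_def)
    then have "card (nbrs y \<inter> nbrs z) \<le> card (D - {ix y, ix z})"
      using finD by (intro card_mono) auto
    also have "\<dots> = t - 2" using ne ixD yz cardD finD by (simp add: card_Diff_subset)
    finally show False using card_common_nbrs[of y z] yz t2 by (auto simp: Y_def B_def)
  qed
  have dichotomy: "card Y \<le> card (induced_edges B) + 1 \<or> (\<exists>x\<in>D. \<forall>y\<in>Y. ix y = x)"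
  proof (cases "Y = {}")
    case False
    then obtain y0 where y0: "y0 \<in> Y" by blast
    then have "y0 \<in> B" by (simp add: Y_def)
    then obtain S where S: "y0 \<in> S" "S \<subseteq> B" "card S \<le> card (induced_edges S) + 1"
      and closed: "\<And>s b. s \<in> S \<Longrightarrow> b \<in> B - S \<Longrightarrow> b \<notin> nbrs s"
      using closed_set_few_vertices[OF finB] by metis
    show ?thesis
    proof (cases "Y \<subseteq> S")
      case True
      have "card Y \<le> card S" using True S finB by (meson card_mono finite_subset)
      moreover have "card (induced_edges S) \<le> card (induced_edges B)"
        using S finite_induced_edges by (intro card_mono) (auto simp: induced_edges_def)
      ultimately show ?thesis using S by simp
    next
      case nsub: False
      have cross: "ix y = ix z" if "y \<in> Y \<inter> S" "z \<in> Y - S" for y z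
      proof (rule ix_eq)
        have zB: "z \<in> B - S" using that by (auto simp: Y_def)
        show "z \<notin> nbrs y" using closed zB that by blast
        show "nbrs y \<inter> nbrs z \<inter> B = {}"
        proof (rule ccontr)
          assume "nbrs y \<inter> nbrs z \<inter> B \<noteq> {}"
          then obtain c where c: "c \<in> nbrs y" "c \<in> nbrs z" "c \<in> B" by blast
          then have "c \<in> S" using closed that by blast
          then show False using closed[OF _ zB] c nbrs_sym by blast
        qed
      qed (use that in auto)
      from nsub obtain y1 where y1: "y1 \<in> Y - S" by blast
      have "ix y = ix y0" if "y \<in> Y" for y
        using cross[of y y1] cross[of y0 y1] cross[of y0 y] that y0 y1 S(1) by (cases "y \<in> S") auto
      then show ?thesis using ixD y0 by blast
    qed
  qed simp

  have card_Y_le: "card Y \<le> card (induced_edges B)"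
    if p: "\<And>y. y \<in> Y \<Longrightarrow> p y \<in> nbrs y \<inter> B - Y" for p
  proof -
    have "inj_on (\<lambda>y. {y, p y}) Y" using p by (auto simp: inj_on_def doubleton_eq_iff)
    moreover have "(\<lambda>y. {y, p y}) ` Y \<subseteq> induced_edges B" using p by (auto simp: induced_edges_def nbrs_def Y_def)
    ultimately show ?thesis using finite_induced_edges card_inj_on_le by blast
  qed
  \<comment> \<open>Common neighbours of \<open>y\<close> and \<open>x\<close> inside \<open>D\<close> are among its \<open>t - 2\<close> vertices other than
    \<open>x\<close> and \<open>x'\<close>.\<close>
  have outside: "\<exists>z \<in> nbrs y \<inter> B. z \<in> nbrs x"
    if x: "x \<in> D" "x' \<in> D" "x' \<noteq> x" "x' \<notin> nbrs x" and y: "y \<in> Y" "ix y = x" for x x' y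
  proof (rule ccontr)
    assume "\<not> ?thesis"
    then have "nbrs y \<inter> nbrs x \<subseteq> D - {x, x'}"
      using x nbsplit[of y] vnb[of y] y nbrs_irrefl by (auto simp: Y_def)
    then have "card (nbrs y \<inter> nbrs x) \<le> card (D - {x, x'})"
      using finD by (intro card_mono) auto
    also have "\<dots> = t - 2" using x cardD finD by (simp add: card_Diff_subset)
    finally have le: "card (nbrs y \<inter> nbrs x) \<le> t - 2" .
    have "y \<noteq> x" using y x by (auto simp: Y_def B_def)
    then have "t - 1 \<le> card (nbrs y \<inter> nbrs x)"
      using card_common_nbrs[of y x] y x DV ixn[OF y(1)] by (auto simp: Y_def B_def)
    then show False using le t2 by simp
  qed

  have "B \<noteq> {}" using n cardV by auto
  then obtain x where x: "x \<in> D" and xc: "\<forall>p\<in>D-{x}. \<forall>q\<in>D-{x}. p \<noteq> q \<longrightarrow> q \<in> nbrs p"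
    using miss by blast
  define M where "M = {w \<in> D - {x}. w \<notin> nbrs x}"
  have finM: "finite M" using finD M_def by simp
  have esD: "t choose 2 \<le> card (induced_edges D) + card M"
  proof -
    have "{e. e \<subseteq> D \<and> card e = 2} \<subseteq> induced_edges D \<union> (\<lambda>w. {x, w}) ` M"
    proof
      fix e assume e: "e \<in> {e. e \<subseteq> D \<and> card e = 2}"
      then obtain p q where pq: "e = {p, q}" "p \<noteq> q" by (auto simp: card_2_iff)
      show "e \<in> induced_edges D \<union> (\<lambda>w. {x, w}) ` M"
      proof (cases "e \<in> E")
        case True then show ?thesis using e by (auto simp: induced_edges_def)
      next
        case False
        then have nn: "q \<notin> nbrs p" "p \<notin> nbrs q" using pq by (auto simp: nbrs_def insert_commute)
        have "p = x \<or> q = x" using xc nn pq e by blast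
        then show ?thesis
        proof
          assume "p = x"
          then show ?thesis using pq nn e by (auto simp: M_def)
        next
          assume "q = x"
          then have "p \<in> M" "e = {x, p}" using pq nn e by (auto simp: M_def)
          then show ?thesis by blast
        qed
      qed
    qed
    then have "card {e. e \<subseteq> D \<and> card e = 2} \<le> card (induced_edges D \<union> (\<lambda>w. {x, w}) ` M)"
      using finite_induced_edges finM by (intro card_mono) auto
    also have "\<dots> \<le> card (induced_edges D) + card M"
      using card_Un_le[of "induced_edges D"] card_image_le[OF finM, of "\<lambda>w. {x, w}"] by (meson add_left_mono le_trans)
    finally show ?thesis using n_subsets[OF finD, of 2] cardD by simp
  qed
  have main: "card Y + card M \<le> card (induced_edges B) + 2"
  proof -
    consider (none) "M = {}" | (one) x' where "M = {x'}" | (many) "2 \<le> card M"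
    proof -
      have "card M = 0 \<or> card M = 1 \<or> 2 \<le> card M" by linarith
      then show ?thesis using that finM by (auto simp: card_1_singleton_iff)
    qed
    then show ?thesis
    proof cases
      case none
      \<comment> \<open>Now \<open>D\<close> is a clique, so every vertex of \<open>D\<close> is missed by some vertex of \<open>Y\<close>.\<close>
      have "\<exists>y\<in>Y. ix y = z" if z: "z \<in> D" for z
      proof -
        obtain w where w: "w \<in> V" "w \<noteq> z" "w \<notin> nbrs z" using no_cone[of z] z DV by auto
        have "w \<notin> D"
          using w xc z none by (cases "z = x"; cases "w = x") (auto simp: M_def nbrs_sym)
        moreover have "w \<noteq> v" using w z nbrs_sym D_def by auto
        ultimately have "w \<in> B" using w by (simp add: B_def)
        then have "w \<in> Y" using w z nbrs_sym by (auto simp: Y_def)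
        moreover have "ix w = z"
          using ixa[OF \<open>w \<in> Y\<close>] w z nbrs_sym by auto
        ultimately show ?thesis by blast
      qed
      moreover have "\<exists>z\<in>D. z \<noteq> z'" for z'
      proof (rule ccontr)
        assume "\<not> ?thesis"
        then have "D \<subseteq> {z'}" by auto
        then have "card D \<le> 1" using card_mono[of "{z'}" D] by simp
        then show False using cardD t2 by simp
      qed
      ultimately have "\<not> (\<exists>x\<in>D. \<forall>y\<in>Y. ix y = x)" by metis
      then show ?thesis using dichotomy none by auto
    next
      case one
      show ?thesis
      proof (cases "card Y \<le> card (induced_edges B) + 1")
        case True then show ?thesis using one by simp
      next
        case False
        then obtain z where z: "z \<in> D" "\<And>y. y \<in> Y \<Longrightarrow> ix y = z" using dichotomy by auto
        from False obtain y0 where y0: "y0 \<in> Y" by (cases "Y = {}") auto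
        have x': "x' \<in> D" "x' \<noteq> x" "x' \<notin> nbrs x" using one by (auto simp: M_def)
        have "z = x \<or> z = x'"
          using ixc[OF y0, of x x'] z(2)[OF y0] x x' by auto
        then obtain z' where z': "z' \<in> D" "z' \<noteq> z" "z' \<notin> nbrs z"
          using x x' nbrs_sym by metis
        have "\<forall>y\<in>Y. \<exists>u. u \<in> nbrs y \<inter> B - Y"
        proof
          fix y assume y: "y \<in> Y"
          then obtain u where u: "u \<in> nbrs y \<inter> B" "u \<in> nbrs z"
            using outside[of z z' y] z z' by blast
          then have "u \<notin> Y" using ixn[of u] z(2)[of u] nbrs_sym by auto
          then show "\<exists>u. u \<in> nbrs y \<inter> B - Y" using u by blast
        qed
        then obtain p where "\<And>y. y \<in> Y \<Longrightarrow> p y \<in> nbrs y \<inter> B - Y" by (auto simp: bchoice_iff)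
        then have "card Y \<le> card (induced_edges B)" using card_Y_le[of p] by auto
        with False show ?thesis by simp
      qed
    next
      case many
      \<comment> \<open>Each vertex of \<open>Y\<close> has an edge to a common neighbour with \<open>x\<close>, and the clique shared by \<open>x\<close>
        and a vertex of \<open>M\<close> contributes a star with at least \<open>card M - 1\<close> further edges of \<open>B\<close>.\<close>
      have ixx: "ix y = x" if "y \<in> Y" for y
      proof (rule ccontr)
        assume ne: "ix y \<noteq> x"
        have "M \<subseteq> {ix y}" using ixc[OF that, of x] ne x by (auto simp: M_def)
        then have "card M \<le> 1" using card_mono[of "{ix y}" M] by simp
        then show False using many by simp
      qed
      obtain x' where "x' \<in> M" using many by (cases "M = {}") auto
      then have x': "x' \<in> D" "x' \<noteq> x" "x' \<notin> nbrs x" by (auto simp: M_def)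
      obtain Q where Q: "Q \<subseteq> nbrs x \<inter> nbrs x'" "card Q = t - 1"
        and Qc: "\<forall>p\<in>Q. \<forall>q\<in>Q. p \<noteq> q \<longrightarrow> q \<in> nbrs p"
        using linked[of x x'] x x' DV by blast
      have finQ: "finite Q" using Q finite_nbrs finite_subset by blast
      have card_xD: "card (D \<inter> nbrs x) + card M + 1 = t"
      proof -
        have "D = insert x ((D \<inter> nbrs x) \<union> M)" using x by (auto simp: M_def)
        then have "card D = card (insert x ((D \<inter> nbrs x) \<union> M))" by simp
        also have "\<dots> = Suc (card (D \<inter> nbrs x) + card M)"
          using finD finM nbrs_irrefl by (subst card_insert_disjoint) (auto simp: M_def intro!: card_Un_disjoint)
        finally show ?thesis using cardD by simp
      qed
      have QD: "Q \<inter> D \<subseteq> D \<inter> nbrs x" using Q by auto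
      have "card (Q \<inter> D) \<le> card (D \<inter> nbrs x)" using finD QD by (intro card_mono) auto
      \<comment> \<open>A clique through \<open>v\<close> lies in \<open>insert v D\<close>, where \<open>x\<close> has too few neighbours.\<close>
      have "v \<notin> Q"
      proof
        assume vQ: "v \<in> Q"
        have "Q \<subseteq> insert v (D \<inter> nbrs x)" using Qc vQ Q by (auto simp: D_def)
        then have "card Q \<le> card (insert v (D \<inter> nbrs x))" using finD by (intro card_mono) auto
        also have "\<dots> \<le> Suc (card (D \<inter> nbrs x))" using finD by (simp add: card_insert_if)
        finally show False using Q card_xD many by simp
      qed
      then have "Q = (Q \<inter> D) \<union> (Q \<inter> B)" using Q nbsplit[of x] by auto
      moreover have "(Q \<inter> D) \<inter> (Q \<inter> B) = {}" by (auto simp: B_def)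
      ultimately have "card Q = card (Q \<inter> D) + card (Q \<inter> B)"
        using finQ card_Un_disjoint[of "Q \<inter> D" "Q \<inter> B"] by auto
      then have cardQB: "card M \<le> card (Q \<inter> B)"
        using \<open>card (Q \<inter> D) \<le> card (D \<inter> nbrs x)\<close> card_xD Q by simp
      then obtain q where q: "q \<in> Q \<inter> B" using many by (cases "Q \<inter> B = {}") auto
      have QY: "Q \<inter> Y = {}" using Q ixn ixx nbrs_sym by fastforce
      have "\<forall>y\<in>Y. \<exists>u. u \<in> nbrs y \<inter> B \<and> u \<in> nbrs x"
        using outside[of x x'] x x' ixx by blast
      then obtain f where f: "\<And>y. y \<in> Y \<Longrightarrow> f y \<in> nbrs y \<inter> B \<and> f y \<in> nbrs x" by (auto simp: bchoice_iff)
      have fY: "f y \<notin> Y" if "y \<in> Y" for y using f[OF that] ixn ixx nbrs_sym by fastforce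
      define R where "R = Q \<inter> B - {q}"
      have inj: "inj_on (\<lambda>y. {y, f y}) Y" using fY by (auto simp: inj_on_def doubleton_eq_iff)
      have injR: "inj_on (\<lambda>u. {q, u}) R" by (auto simp: inj_on_def doubleton_eq_iff)
      have disj: "(\<lambda>y. {y, f y}) ` Y \<inter> (\<lambda>u. {q, u}) ` R = {}"
        using QY q by (auto simp: R_def doubleton_eq_iff)
      have "(\<lambda>y. {y, f y}) ` Y \<union> (\<lambda>u. {q, u}) ` R \<subseteq> induced_edges B"
        using f q Qc by (auto simp: induced_edges_def nbrs_def R_def Y_def)
      then have "card ((\<lambda>y. {y, f y}) ` Y \<union> (\<lambda>u. {q, u}) ` R) \<le> card (induced_edges B)"
        using finite_induced_edges by (intro card_mono) auto
      then have "card Y + card R \<le> card (induced_edges B)"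
        using disj inj injR finY finQ by (simp add: card_Un_disjoint card_image R_def)
      moreover have "card R = card (Q \<inter> B) - 1" using q finQ by (simp add: R_def)
      ultimately show ?thesis using cardQB many by simp
    qed
  qed
  have "t * t + t = 2 * (Suc t choose 2)" by (simp add: choose_two)
  moreover have "(Suc t choose 2) = t + (t choose 2)" by (simp add: numeral_2_eq_2)
  ultimately have "t * t = 2 * (t choose 2) + t" by simp
  then show ?thesis
    using main esD dcount cardE cardV \<open>(Suc t choose 2) = t + (t choose 2)\<close>
    by (simp add: algebra_simps)
qed

text \<open>Let \<open>v\<close> have degree less than \<open>2 * t\<close>, with neighbourhood \<open>D\<close>. Every vertex of the remainder \<open>B\<close> has at
  least \<open>t - 1\<close> neighbours in \<open>D\<close> and, by the minimum degree, enough others for a total of at least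
  \<open>t + 1\<close>. Fewer than \<open>t * card V\<close> edges therefore force all but boundedly many vertices of \<open>B\<close> to have
  exactly \<open>t - 1\<close> neighbours in \<open>D\<close>, and all degrees inside \<open>B\<close> to be bounded. So almost all pairs of
  vertices of \<open>B\<close> have no common neighbour in \<open>B\<close>, and must see the same set \<open>S\<close> of \<open>t - 1\<close> vertices of
  \<open>D\<close>. Every vertex of \<open>S\<close> is then a cone.\<close>

lemma cone_if_min_degree_gt_t:
  assumes min: "\<And>u. u \<in> V \<Longrightarrow> t + 1 \<le> card (nbrs u)"
    and sparse: "card E < t * card V" and n: "cone_threshold t \<le> card V"
  shows "\<exists>c\<in>V. \<forall>w\<in>V. w \<noteq> c \<longrightarrow> w \<in> nbrs c"
proof -
  have "\<exists>v\<in>V. card (nbrs v) < 2 * t"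
  proof (rule ccontr)
    assume "\<not> ?thesis"
    then have "(\<Sum>v\<in>V. 2 * t) \<le> (\<Sum>v\<in>V. card (nbrs v \<inter> V))"
      using nbrs_subset by (intro sum_mono) (simp add: Int_absorb2 not_less)
    also have "\<dots> = 2 * card E" using handshake[OF finV] induced_edges_V by simp
    finally show False using sparse by (simp add: mult.commute)
  qed
  then obtain v where v: "v \<in> V" "card (nbrs v) < 2 * t" by blast
  define D where "D = nbrs v"
  define B where "B = V - insert v D"
  define m where "m = 4 * t * t + 1"
  define l where "l = m * m + 2 * m"
  have finD: "finite D" and finB: "finite B" and BV: "B \<subseteq> V"
    using finite_nbrs finV by (auto simp: D_def B_def)
  have vnb: "b \<in> B \<Longrightarrow> v \<notin> nbrs b" for b using nbrs_sym by (auto simp: B_def D_def)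
  have nbsplit: "nbrs x \<subseteq> insert v (D \<union> B)" for x using nbrs_subset[of x] by (auto simp: B_def)
  have cardV: "card V = card B + card D + 1"
    using vertex_count[of v B] v by (simp add: B_def D_def)
  have cardE: "card E = card D + card (induced_edges D) + card (induced_edges B) + (\<Sum>b\<in>B. card (nbrs b \<inter> D))"
    using edge_count[of v B] v by (simp add: B_def D_def)
  have cardB: "1 + 2 * l + l * m < card B"
    using n cardV v(2) by (simp add: cone_threshold_def Let_def D_def m_def l_def)

  define d where "d b = card (nbrs b \<inter> D)" for b
  define c where "c b = card (nbrs b \<inter> B)" for b
  define x where "x b = 2 * d b + c b - 2 * t" for b
  have dge: "t - 1 \<le> d b" if b: "b \<in> B" for b
  proof -
    have "t - 1 \<le> card (nbrs v \<inter> nbrs b)"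
      using card_common_nbrs[of v b] b v by (auto simp: B_def D_def)
    then show ?thesis by (simp add: d_def D_def Int_commute)
  qed
  have dc: "t + 1 \<le> d b + c b" if b: "b \<in> B" for b
  proof -
    have "card (nbrs b) = card ((nbrs b \<inter> D) \<union> (nbrs b \<inter> B))"
      using nbsplit[of b] vnb[OF b] by (intro arg_cong[where f = card]) auto
    also have "\<dots> \<le> d b + c b" unfolding d_def c_def by (rule card_Un_le)
    finally show ?thesis using min[of b] b BV by auto
  qed
  \<comment> \<open>Charge to each vertex of \<open>B\<close> its edges into \<open>D\<close> and half of its edges inside \<open>B\<close>:
    everyone receives at least \<open>t\<close>, and \<open>x b\<close> is twice the excess.\<close>
  have x_eq: "x b + 2 * t = 2 * d b + c b" if b: "b \<in> B" for b
    using dge[OF b] dc[OF b] t2 by (simp add: x_def)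
  have sum_x: "sum x B < 4 * t * t"
  proof -
    have "sum x B + 2 * t * card B = (\<Sum>b\<in>B. x b + 2 * t)"
      by (simp add: sum.distrib mult.commute)
    also have "\<dots> = (\<Sum>b\<in>B. 2 * d b + c b)" using x_eq by (intro sum.cong) auto
    also have "\<dots> = 2 * sum d B + 2 * card (induced_edges B)"
      using handshake[OF finB] by (simp add: sum.distrib sum_distrib_left c_def)
    also have "\<dots> \<le> 2 * card E" using cardE by (simp add: d_def[abs_def])
    also have "\<dots> < 2 * t * card V" using sparse by simp
    also have "\<dots> = 2 * t * card B + 2 * t * (card D + 1)" using cardV by (simp add: algebra_simps)
    also have "2 * t * (card D + 1) \<le> 2 * t * (2 * t)"
      using v(2) by (intro mult_le_mono) (auto simp: D_def)
    finally show ?thesis by simp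
  qed
  have c_le: "c b \<le> m" if b: "b \<in> B" for b
    using sum_x member_le_sum[OF b, of x] finB x_eq[OF b] dge[OF b] t2
    by (simp add: m_def)
  define X where "X = {b \<in> B. d b = t - 1}"
  have "card (B - X) < m"
  proof -
    have "1 \<le> x b" if "b \<in> B - X" for b
      using that dge[of b] dc[of b] x_eq[of b] by (auto simp: X_def)
    then have "card (B - X) \<le> sum x (B - X)"
      using sum_mono[of "B - X" "\<lambda>_. 1" x] by simp
    also have "\<dots> \<le> sum x B" using finB by (intro sum_mono2) auto
    finally show ?thesis using sum_x by (simp add: m_def)
  qed

  define R where "R A = (\<Union>a\<in>A. nbrs a \<inter> B)" for A
  have card_R: "card (R A) \<le> card A * m" if A: "A \<subseteq> B" for A
  proof -
    have "finite A" using A finB finite_subset by blast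
    then have "card (R A) \<le> (\<Sum>a\<in>A. card (nbrs a \<inter> B))" unfolding R_def by (rule card_UN_le)
    also have "\<dots> \<le> (\<Sum>a\<in>A. m)" using c_le A by (intro sum_mono) (auto simp: c_def)
    finally show ?thesis by simp
  qed
  have finR: "finite (R A)" for A
    using finB finite_subset[of "R A" B] by (auto simp: R_def)

  \<comment> \<open>Two vertices of \<open>X\<close> that are far apart inside \<open>B\<close> share \<open>t - 1\<close> neighbours
    in \<open>D\<close>, so these are all of their neighbours there.\<close>
  have "X \<noteq> {}"
  proof
    assume "X = {}"
    then have "card B < m" using \<open>card (B - X) < m\<close> by simp
    then show False using cardB by (simp add: l_def)
  qed
  then obtain b0 where b0: "b0 \<in> X" by blast
  then have b0B: "b0 \<in> B" by (simp add: X_def)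
  define S where "S = nbrs b0 \<inter> D"
  have cardS: "card S = t - 1" using b0 by (simp add: X_def d_def S_def)
  have finS: "finite S" using finD by (simp add: S_def)
  define X' where "X' = {b \<in> B. nbrs b \<inter> D = S}"
  have "B - X' \<subseteq> (B - X) \<union> ({b0} \<union> ((nbrs b0 \<inter> B) \<union> R (nbrs b0 \<inter> B)))"
  proof (rule ccontr)
    assume "\<not> ?thesis"
    then obtain b where b: "b \<in> X" "b \<notin> X'" "b \<noteq> b0" "b \<notin> nbrs b0" "b \<notin> R (nbrs b0 \<inter> B)"
      by (auto simp: X_def)
    then have bB: "b \<in> B" by (simp add: X_def)
    have "nbrs b0 \<inter> nbrs b \<subseteq> S \<inter> (nbrs b \<inter> D)"
      using nbsplit[of b] vnb[OF bB] b(5) bB nbrs_sym by (auto simp: S_def R_def)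
    then have "card (nbrs b0 \<inter> nbrs b) \<le> card (S \<inter> (nbrs b \<inter> D))"
      using finS by (intro card_mono) auto
    moreover have "t - 1 \<le> card (nbrs b0 \<inter> nbrs b)"
      using b b0B bB BV by (intro card_common_nbrs) auto
    ultimately have "t - 1 \<le> card (S \<inter> (nbrs b \<inter> D))" by simp
    moreover have "card (nbrs b \<inter> D) = t - 1" using b by (simp add: X_def d_def)
    ultimately have "S \<inter> (nbrs b \<inter> D) = S" "S \<inter> (nbrs b \<inter> D) = nbrs b \<inter> D"
      using cardS finS finD by (intro card_seteq; auto)+
    then show False using b(2) bB by (auto simp: X'_def)
  qed
  then have "card (B - X') \<le> card ((B - X) \<union> ({b0} \<union> ((nbrs b0 \<inter> B) \<union> R (nbrs b0 \<inter> B))))"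
    using finB finR by (intro card_mono) auto
  also have "\<dots> \<le> card (B - X) + (1 + (card (nbrs b0 \<inter> B) + card (R (nbrs b0 \<inter> B))))"
    by (intro order.trans[OF card_Un_le] add_mono order.refl) auto
  also have "\<dots> \<le> l"
  proof -
    have "card (R (nbrs b0 \<inter> B)) \<le> m * m"
      using card_R[OF Int_lower2, of "nbrs b0"] mult_le_mono1[OF c_le[OF b0B], of m]
      unfolding c_def by linarith
    then show ?thesis
      using \<open>card (B - X) < m\<close> c_le[OF b0B] by (simp add: c_def l_def)
  qed
  finally have card_BX': "card (B - X') \<le> l" .
  have S_clique: "\<forall>p\<in>S. \<forall>q\<in>S. p \<noteq> q \<longrightarrow> q \<in> nbrs p"
  proof -
    obtain Q where Q: "Q \<subseteq> nbrs v \<inter> nbrs b0" "card Q = t - 1"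
      "\<forall>p\<in>Q. \<forall>q\<in>Q. p \<noteq> q \<longrightarrow> q \<in> nbrs p"
      using linked[of v b0] v b0B by (auto simp: B_def D_def)
    have "Q = S" using Q cardS finS by (intro card_seteq) (auto simp: S_def D_def)
    then show ?thesis using Q by simp
  qed

  \<comment> \<open>A non-neighbour \<open>w\<close> of \<open>s\<close> would have to be close, inside \<open>B\<close>, to every vertex of \<open>X'\<close>,
    because the common neighbours in \<open>S\<close> avoid \<open>s\<close> and so are one too few.\<close>
  have "S \<noteq> {}" using cardS t2 by auto
  then obtain s where s: "s \<in> S" by blast
  have "w \<in> nbrs s" if w: "w \<in> V" "w \<noteq> s" for w
  proof (rule ccontr)
    assume nw: "w \<notin> nbrs s"
    have "w \<notin> S" using S_clique s w(2) nw by metis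
    have "w \<noteq> v" using nw s nbrs_sym by (auto simp: S_def D_def)
    have near: "X' \<subseteq> {w} \<union> ((nbrs w \<inter> B) \<union> R (nbrs w \<inter> B))"
    proof
      fix b assume b: "b \<in> X'"
      then have bB: "b \<in> B" by (simp add: X'_def)
      show "b \<in> {w} \<union> ((nbrs w \<inter> B) \<union> R (nbrs w \<inter> B))"
      proof (rule ccontr)
        assume far: "\<not> ?thesis"
        then have "b \<noteq> w" "w \<notin> nbrs b" using bB nbrs_sym by auto
        then have ge: "t - 1 \<le> card (nbrs b \<inter> nbrs w)"
          using card_common_nbrs[of b w] bB BV w by auto
        have "nbrs b \<inter> nbrs w \<subseteq> S - {s}"
          using nbsplit[of b] vnb[OF bB] b far nw bB nbrs_sym by (auto simp: X'_def R_def)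
        then have "card (nbrs b \<inter> nbrs w) \<le> card (S - {s})" using finS by (intro card_mono) auto
        then show False using ge cardS finS s t2 by simp
      qed
    qed
    have bound: "card X' \<le> 1 + l + l * m"
    proof -
      consider "w \<in> B" | "w \<in> D" using w \<open>w \<noteq> v\<close> by (auto simp: B_def)
      then have "card (nbrs w \<inter> B) \<le> l"
      proof cases
        case 1
        then show ?thesis using c_le[of w] by (simp add: c_def l_def)
      next
        case 2
        then have "nbrs w \<inter> B \<subseteq> B - X'" using \<open>w \<notin> S\<close> nbrs_sym by (auto simp: X'_def)
        then have "card (nbrs w \<inter> B) \<le> card (B - X')" using finB by (intro card_mono) auto
        then show ?thesis using card_BX' by simp
      qed
      then have "card (R (nbrs w \<inter> B)) \<le> l * m"
        using card_R[of "nbrs w \<inter> B"] mult_le_mono1[of _ l m] by (meson inf_le2 le_trans)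
      have "card X' \<le> card ({w} \<union> ((nbrs w \<inter> B) \<union> R (nbrs w \<inter> B)))"
        using near finB finR by (intro card_mono) auto
      also have "\<dots> \<le> 1 + (card (nbrs w \<inter> B) + card (R (nbrs w \<inter> B)))"
        by (intro order.trans[OF card_Un_le] add_mono order.refl) auto
      finally show ?thesis
        using \<open>card (nbrs w \<inter> B) \<le> l\<close> \<open>card (R (nbrs w \<inter> B)) \<le> l * m\<close> by simp
    qed
    have "card B = card (X' \<union> (B - X'))"
      by (intro arg_cong[where f = card]) (auto simp: X'_def)
    also have "\<dots> \<le> card X' + card (B - X')" by (rule card_Un_le)
    finally show False using bound card_BX' cardB by simp
  qed
  moreover have "s \<in> V" using s nbrs_subset by (auto simp: S_def)
  ultimately show ?thesis by blast
qed

text \<open>The degree \<open>t\<close> is where the exact constant matters; below it there is a cone at once, and above it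
  the threshold on \<open>card V\<close> absorbs all constants.\<close>

theorem cone_if_few_edges:
  assumes n: "cone_threshold t \<le> card V"
    and sparse: "card E + (Suc t choose 2) + 2 < t * card V"
  shows "\<exists>c\<in>V. \<forall>w\<in>V. w \<noteq> c \<longrightarrow> w \<in> nbrs c"
proof (rule ccontr)
  assume no_cone: "\<not> ?thesis"
  have nt: "t + 1 < card V" using n t2 by (simp add: cone_threshold_def Let_def)
  have "t + 1 \<le> card (nbrs u)" if u: "u \<in> V" for u
  proof -
    have "card (nbrs u) \<noteq> t"
      using edges_if_degree_t[OF u _ nt] no_cone sparse by fastforce
    moreover have "\<not> card (nbrs u) < t"
    proof
      assume small: "card (nbrs u) < t"
      have "nbrs u \<noteq> {}"
      proof
        assume e: "nbrs u = {}"
        have "\<not> V \<subseteq> {u}" using nt card_mono[of "{u}" V] by auto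
        then obtain w where "w \<in> V" "w \<noteq> u" by blast
        then show False using card_common_nbrs[OF u, of w] e t2 by simp
      qed
      then obtain x where "x \<in> nbrs u" by blast
      then show False
        using cone_of_degree_small[OF u small _ \<open>x \<in> nbrs u\<close>] nt no_cone nbrs_subset by fastforce
    qed
    ultimately show ?thesis by simp
  qed
  then show False using cone_if_min_degree_gt_t n sparse no_cone by fastforce
qed

end

section \<open>Embeddings and deletion of a cone vertex\<close>

definition embeds :: "('a \<Rightarrow> 'b) \<Rightarrow> 'a ugraph \<Rightarrow> 'b ugraph \<Rightarrow> bool" where
  "embeds f P G \<longleftrightarrow> inj_on f (uverts P) \<and> f ` uverts P \<subseteq> uverts G \<and>
     (\<forall>e\<in>uedges P. f ` e \<in> uedges G)"

lemma contains_copy_iff_embeds: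
  assumes "simple_graph P"
  shows "contains_copy G P \<longleftrightarrow> (\<exists>f. embeds f P G)"
proof
  assume "contains_copy G P"
  then obtain H f where H: "subgraph H G" "bij_betw f (uverts P) (uverts H)"
    "uedges H = (\<lambda>e. f ` e) ` uedges P"
    by (auto simp: contains_copy_def copy_in_def isomorphic_def)
  then have "embeds f P G" by (auto simp: embeds_def subgraph_def bij_betw_def)
  then show "\<exists>f. embeds f P G" by blast
next
  assume "\<exists>f. embeds f P G"
  then obtain f where f: "embeds f P G" ..
  define H where "H = (f ` uverts P, (\<lambda>e. f ` e) ` uedges P)"
  have inj: "inj_on f (uverts P)" using f by (simp add: embeds_def)
  have "card (f ` e) = 2" if "e \<in> uedges P" for e
  proof -
    have e: "e \<subseteq> uverts P" "card e = 2" using assms that by (auto simp: simple_graph_def)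
    then show ?thesis using inj by (simp add: card_image inj_on_subset)
  qed
  then have "simple_graph H" using assms by (fastforce simp: simple_graph_def H_def)
  then have "subgraph H G" using f by (auto simp: subgraph_def embeds_def H_def)
  moreover have "isomorphic P H"
    unfolding isomorphic_def using inj by (intro exI[of _ f]) (auto simp: H_def bij_betw_def)
  ultimately show "contains_copy G P" unfolding contains_copy_def copy_in_def by blast
qed

lemma simple_edge:
  assumes "simple_graph G" "e \<in> uedges G"
  obtains u w where "e = {u, w}" "u \<noteq> w" "u \<in> uverts G" "w \<in> uverts G"
proof -
  from assms have "card e = 2" "e \<subseteq> uverts G" by (auto simp: simple_graph_def)
  then show thesis using that by (auto simp: card_2_iff)
qed

lemma simple_add_edge: "simple_graph G \<Longrightarrow> e \<in> nonedges G \<Longrightarrow> simple_graph (add_edge G e)"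
  by (auto simp: simple_graph_def add_edge_def nonedges_def)

text \<open>The adjacency form of \<open>conical\<close>, which does not mention the number of vertices.\<close>

definition cone :: "'a ugraph \<Rightarrow> 'a \<Rightarrow> bool" where
  "cone G c \<longleftrightarrow> c \<in> uverts G \<and> (\<forall>w\<in>uverts G. w \<noteq> c \<longrightarrow> {c, w} \<in> uedges G)"

definition del_vert :: "'a ugraph \<Rightarrow> 'a \<Rightarrow> 'a ugraph" where
  "del_vert G c = (uverts G - {c}, {e \<in> uedges G. c \<notin> e})"

lemma simple_del_vert: "simple_graph G \<Longrightarrow> simple_graph (del_vert G c)"
  by (auto simp: simple_graph_def del_vert_def)

text \<open>If a vertex \<open>u\<close> other than \<open>a\<close> is mapped to \<open>c\<close>, the image of \<open>a\<close> can replace \<open>c\<close> as the image of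
  \<open>u\<close>: it is adjacent to the images of all other vertices of the pattern.\<close>

lemma contains_copy_del_cone:
  assumes P: "simple_graph P" "cone P a" and G: "simple_graph G" "cone G c"
  shows "contains_copy G P \<longleftrightarrow> contains_copy (del_vert G c) (del_vert P a)"
proof -
  have "\<exists>g. embeds g (del_vert P a) (del_vert G c)" if f: "embeds f P G" for f
  proof -
    have inj: "\<And>u w. u \<in> uverts P \<Longrightarrow> w \<in> uverts P \<Longrightarrow> f u = f w \<longleftrightarrow> u = w"
      using f by (auto simp: embeds_def inj_on_def)
    have aP: "a \<in> uverts P" using P by (simp add: cone_def)
    define g where "g u = (if f u = c then f a else f u)" for u
    have "embeds g (del_vert P a) (del_vert G c)"
      unfolding embeds_def
    proof (intro conjI ballI)
      show "inj_on g (uverts (del_vert P a))"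
        using inj aP by (fastforce simp: inj_on_def g_def del_vert_def split: if_splits)
      show "g ` uverts (del_vert P a) \<subseteq> uverts (del_vert G c)"
        using f inj aP by (auto simp: embeds_def g_def del_vert_def)
      fix e assume e: "e \<in> uedges (del_vert P a)"
      then have eP: "e \<in> uedges P" and "a \<notin> e" by (auto simp: del_vert_def)
      from P(1) eP obtain u w where uw: "e = {u, w}" "u \<noteq> w" "u \<in> uverts P" "w \<in> uverts P"
        by (rule simple_edge)
      have ne: "u \<noteq> a" "w \<noteq> a" using uw \<open>a \<notin> e\<close> by auto
      have "f ` e \<in> uedges G" using f eP by (simp add: embeds_def)
      then have fe: "{f u, f w} \<in> uedges G" using uw by simp
      have fa: "{f a, f x} \<in> uedges G" if "x \<in> uverts P" "x \<noteq> a" for x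
      proof -
        have "{a, x} \<in> uedges P" using P that by (simp add: cone_def)
        then have "f ` {a, x} \<in> uedges G" using f by (simp only: embeds_def)
        then show ?thesis by simp
      qed
      have "{g u, g w} \<in> uedges G" using fe fa[of u] fa[of w] uw ne inj
        by (auto simp: g_def insert_commute)
      moreover have "g u \<noteq> c" "g w \<noteq> c" using inj[of u a] inj[of w a] uw ne aP by (auto simp: g_def)
      ultimately show "g ` e \<in> uedges (del_vert G c)" using uw by (auto simp: del_vert_def)
    qed
    then show ?thesis by blast
  qed
  moreover have "\<exists>f. embeds f P G" if g: "embeds g (del_vert P a) (del_vert G c)" for g
  proof -
    have inj: "inj_on g (uverts P - {a})" and gV: "g ` (uverts P - {a}) \<subseteq> uverts G - {c}"
      using g by (auto simp: embeds_def del_vert_def)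
    define f where "f = g(a := c)"
    have "embeds f P G"
      unfolding embeds_def
    proof (intro conjI ballI)
      show "inj_on f (uverts P)"
        using inj gV by (auto simp: inj_on_def f_def)
      show "f ` uverts P \<subseteq> uverts G"
        using gV G by (auto simp: f_def cone_def)
      fix e assume e: "e \<in> uedges P"
      show "f ` e \<in> uedges G"
      proof (cases "a \<in> e")
        case True
        from P(1) e obtain u w where uw: "e = {u, w}" "u \<noteq> w" "u \<in> uverts P" "w \<in> uverts P"
          by (rule simple_edge)
        with True obtain x where x: "e = {a, x}" "x \<noteq> a" "x \<in> uverts P" by auto
        then have "g x \<in> uverts G" "g x \<noteq> c" using gV by auto
        then have "{c, g x} \<in> uedges G" using G by (simp add: cone_def)
        then show ?thesis using x by (simp add: f_def insert_commute)
      next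
        case False
        then have "f ` e = g ` e" by (auto simp: f_def)
        then show ?thesis using g e False by (auto simp: embeds_def del_vert_def)
      qed
    qed
    then show ?thesis by blast
  qed
  ultimately show ?thesis
    using contains_copy_iff_embeds P(1) simple_del_vert by metis
qed

text \<open>A cone vertex of the host lies on no non-edge, so adding an edge and deleting the cone commute.\<close>

lemma saturated_del_cone:
  assumes P: "simple_graph P" "cone P a" and G: "simple_graph G" "cone G c"
  shows "saturated P G \<longleftrightarrow> saturated (del_vert P a) (del_vert G c)"
proof -
  have ne: "nonedges (del_vert G c) = nonedges G"
  proof (intro set_eqI iffI)
    fix e assume e: "e \<in> nonedges G"
    then obtain u w where uw: "e = {u, w}" "u \<noteq> w" by (auto simp: nonedges_def card_2_iff)
    have "c \<notin> e" using e uw G by (auto simp: nonedges_def cone_def insert_commute)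
    then show "e \<in> nonedges (del_vert G c)" using e by (auto simp: nonedges_def del_vert_def)
  qed (auto simp: nonedges_def del_vert_def)
  have "contains_copy (add_edge G e) P \<longleftrightarrow>
      contains_copy (add_edge (del_vert G c) e) (del_vert P a)" if e: "e \<in> nonedges G" for e
  proof -
    have "e \<in> nonedges (del_vert G c)" using e ne by simp
    then have "c \<notin> e" by (auto simp: nonedges_def del_vert_def)
    then have "del_vert (add_edge G e) c = add_edge (del_vert G c) e"
      by (auto simp: del_vert_def add_edge_def)
    moreover have "cone (add_edge G e) c" using G by (auto simp: cone_def add_edge_def)
    ultimately show ?thesis
      using contains_copy_del_cone[OF P simple_add_edge[OF G(1) e], of c] by simp
  qed
  then show ?thesis
    using contains_copy_del_cone[OF P G] G(1) simple_del_vert[OF G(1)] ne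
    by (simp add: saturated_def)
qed

definition map_graph :: "('a \<Rightarrow> 'b) \<Rightarrow> 'a ugraph \<Rightarrow> 'b ugraph" where
  "map_graph h G = (h ` uverts G, (\<lambda>e. h ` e) ` uedges G)"

lemma simple_map_graph:
  assumes "simple_graph G" "inj_on h (uverts G)"
  shows "simple_graph (map_graph h G)"
  unfolding simple_graph_def
proof (intro conjI ballI)
  show "finite (uverts (map_graph h G))" using assms by (simp add: simple_graph_def map_graph_def)
  fix e assume "e \<in> uedges (map_graph h G)"
  then obtain e' where e': "e = h ` e'" "e' \<in> uedges G" by (auto simp: map_graph_def)
  then have "e' \<subseteq> uverts G" "card e' = 2" using assms by (auto simp: simple_graph_def)
  then show "e \<subseteq> uverts (map_graph h G)" "card e = 2"
    using e' assms(2) by (auto simp: map_graph_def card_image inj_on_subset)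
qed

lemma inv_map_graph:
  assumes "simple_graph G" "inj_on h (uverts G)"
  shows "map_graph (inv_into (uverts G) h) (map_graph h G) = G"
proof -
  have *: "inv_into (uverts G) h ` h ` A = A" if "A \<subseteq> uverts G" for A
    using that assms(2) by (simp add: inv_into_image_cancel)
  then have "(\<lambda>e. inv_into (uverts G) h ` e) ` (\<lambda>e. h ` e) ` uedges G = uedges G"
    using assms(1) by (force simp: simple_graph_def image_image)
  then show ?thesis using * by (simp add: map_graph_def)
qed

lemma embeds_comp: "embeds f P G \<Longrightarrow> embeds g G H \<Longrightarrow> embeds (g \<circ> f) P H"
  unfolding embeds_def image_comp[symmetric]
  by (auto simp del: image_comp intro: comp_inj_on inj_on_subset)

lemma embeds_map_graph: "inj_on h (uverts G) \<Longrightarrow> embeds h G (map_graph h G)"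
  by (auto simp: embeds_def map_graph_def)

lemma embeds_map_graph_inv:
  assumes "simple_graph G" "inj_on h (uverts G)"
  shows "embeds (inv_into (uverts G) h) (map_graph h G) G"
proof -
  have "inj_on (inv_into (uverts G) h) (uverts (map_graph h G))"
    by (simp add: map_graph_def inj_on_inv_into)
  from embeds_map_graph[OF this] show ?thesis using inv_map_graph[OF assms] by simp
qed

lemma contains_copy_map_graph:
  assumes "simple_graph G" "inj_on h (uverts G)" "simple_graph P"
  shows "contains_copy (map_graph h G) P \<longleftrightarrow> contains_copy G P"
  using contains_copy_iff_embeds[OF assms(3)] embeds_comp embeds_map_graph[OF assms(2)]
    embeds_map_graph_inv[OF assms(1,2)] by metis

lemma contains_copy_of_map_graph:
  assumes "simple_graph P" "inj_on h (uverts P)"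
  shows "contains_copy G (map_graph h P) \<longleftrightarrow> contains_copy G P"
  using contains_copy_iff_embeds[OF assms(1)] contains_copy_iff_embeds[OF simple_map_graph[OF assms]]
    embeds_comp embeds_map_graph[OF assms(2)] embeds_map_graph_inv[OF assms] by metis

lemma saturated_map_graph:
  assumes G: "saturated P G" and inj: "inj_on h (uverts G)" and P: "simple_graph P"
  shows "saturated P (map_graph h G)"
proof -
  have simple: "simple_graph G" using G by (simp add: saturated_def)
  have "contains_copy (add_edge (map_graph h G) e) P" if e: "e \<in> nonedges (map_graph h G)" for e
  proof -
    from e obtain e' where e': "e' \<subseteq> uverts G" "e = h ` e'"
      by (auto simp: nonedges_def map_graph_def subset_image_iff)
    have "card e' = 2" using e e' inj by (simp add: nonedges_def card_image inj_on_subset)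
    then have ne: "e' \<in> nonedges G" using e e' by (auto simp: nonedges_def map_graph_def)
    have "add_edge (map_graph h G) e = map_graph h (add_edge G e')"
      using e' by (auto simp: add_edge_def map_graph_def)
    moreover have "contains_copy (add_edge G e') P" using G ne by (simp add: saturated_def)
    moreover have "inj_on h (uverts (add_edge G e'))" using inj by (simp add: add_edge_def)
    ultimately show ?thesis
      using contains_copy_map_graph[OF simple_add_edge[OF simple ne] _ P] by simp
  qed
  then show ?thesis
    using G contains_copy_map_graph[OF simple inj P] simple_map_graph[OF simple inj]
    by (simp add: saturated_def)
qed

text \<open>The minimum in \<open>sat\<close> ranges over graphs on natural numbers; saturation is invariant under
  relabelling, so it bounds graphs on any vertex type.\<close>

lemma sat_le:
  assumes G: "saturated P G" and P: "simple_graph P"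
  shows "sat (card (uverts G)) P \<le> card (uedges G)"
proof -
  have simple: "simple_graph G" using G by (simp add: saturated_def)
  then obtain h :: "_ \<Rightarrow> nat" where h: "inj_on h (uverts G)"
    using finite_imp_inj_to_nat_seg by (fastforce simp: simple_graph_def)
  have "inj_on (\<lambda>e. h ` e) (uedges G)"
    using simple h by (intro inj_on_subset[OF inj_on_image_Pow[OF h]]) (auto simp: simple_graph_def)
  then have "card (uedges (map_graph h G)) = card (uedges G)"
    "card (uverts (map_graph h G)) = card (uverts G)"
    using h by (auto simp: map_graph_def card_image)
  then show ?thesis
    unfolding sat_def using saturated_map_graph[OF G h P] by (intro Least_le) metis
qed

text \<open>A graph without a copy of \<open>P\<close> that has as many edges as possible is saturated. One exists because
  the graph without edges contains no copy.\<close>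

lemma ex_saturated:
  assumes P: "simple_graph P" "uedges P \<noteq> {}"
  shows "\<exists>G :: nat ugraph. saturated P G \<and> card (uverts G) = n"
proof -
  define \<E> where "\<E> = {E. E \<subseteq> Pow {..<n} \<and> (\<forall>e\<in>E. card e = 2) \<and> \<not> contains_copy ({..<n}, E) P}"
  have "finite \<E>" unfolding \<E>_def by (rule finite_subset[of _ "Pow (Pow {..<n})"]) auto
  moreover have "{} \<in> \<E>"
    using P(2) contains_copy_iff_embeds[OF P(1), of "({..<n}, {})"]
    by (auto simp: \<E>_def embeds_def)
  ultimately obtain E where E: "E \<in> \<E>" and mx: "\<And>E'. E' \<in> \<E> \<Longrightarrow> card E' \<le> card E"
    using Max_in[of "card ` \<E>"] Max_ge[of "card ` \<E>"]
    by (metis (no_types, lifting) empty_iff finite_imageI imageE image_eqI)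
  have finite_edges: "finite E" using E finite_subset[of E "Pow {..<n}"] by (auto simp: \<E>_def)
  have "saturated P ({..<n}, E)"
    unfolding saturated_def
  proof (intro conjI ballI)
    show "simple_graph ({..<n}, E)" using E by (auto simp: simple_graph_def \<E>_def)
    show "\<not> contains_copy ({..<n}, E) P" using E by (simp add: \<E>_def)
    fix e assume e: "e \<in> nonedges ({..<n}, E)"
    show "contains_copy (add_edge ({..<n}, E) e) P"
    proof (rule ccontr)
      assume "\<not> ?thesis"
      then have "insert e E \<in> \<E>" using e E by (auto simp: \<E>_def add_edge_def nonedges_def)
      from mx[OF this] show False using e finite_edges by (simp add: nonedges_def)
    qed
  qed
  then show ?thesis by (intro exI[of _ "({..<n}, E)"]) simp
qed

lemma sat_attained:
  assumes "simple_graph P" "uedges P \<noteq> {}"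
  obtains G :: "nat ugraph" where "saturated P G" "card (uverts G) = n" "card (uedges G) = sat n P"
proof -
  have "\<exists>m. \<exists>G :: nat ugraph. saturated P G \<and> card (uverts G) = n \<and> card (uedges G) = m"
    using ex_saturated[OF assms, of n] by blast
  from LeastI_ex[OF this] show thesis using that unfolding sat_def by blast
qed

lemma fin_graph_of_simple: "simple_graph G \<Longrightarrow> fin_graph (uverts G) (uedges G)"
  by unfold_locales (auto simp: simple_graph_def)

lemma nbrs_cone:
  assumes "simple_graph G" "cone G c"
  shows "fin_graph.nbrs (uedges G) c = uverts G - {c}"
proof -
  interpret fin_graph "uverts G" "uedges G" using assms(1) by (rule fin_graph_of_simple)
  show ?thesis using assms(2) nbrs_subset nbrs_irrefl by (fastforce simp: cone_def nbrs_def)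
qed

lemma card_edges_del_cone:
  assumes "simple_graph G" "cone G c"
  shows "card (uedges G) = card (uedges (del_vert G c)) + (card (uverts G) - 1)"
proof -
  interpret fin_graph "uverts G" "uedges G" using assms(1) by (rule fin_graph_of_simple)
  have c: "c \<in> uverts G" using assms(2) by (simp add: cone_def)
  have "induced_edges (uverts G - {c}) = uedges (del_vert G c)"
    using edgeD by (auto simp: induced_edges_def del_vert_def)
  then show ?thesis
    using card_induced_edges_insert[of "uverts G - {c}" c] nbrs_cone[OF assms] c finV induced_edges_V
    by (simp add: insert_absorb)
qed

lemma conical_if_cone:
  assumes "simple_graph G" "cone G c"
  shows "conical G c"
proof -
  interpret fin_graph "uverts G" "uedges G" using assms(1) by (rule fin_graph_of_simple)
  have c: "c \<in> uverts G" using assms(2) by (simp add: cone_def)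
  have "{e \<in> uedges G. c \<in> e} = (\<lambda>w. {c, w}) ` nbrs c"
  proof (intro set_eqI iffI)
    fix e assume e: "e \<in> {e \<in> uedges G. c \<in> e}"
    then have "e \<in> uedges G" by simp
    with assms(1) obtain u w where "e = {u, w}" "u \<noteq> w" by (rule simple_edge)
    with e show "e \<in> (\<lambda>w. {c, w}) ` nbrs c"
      by (auto simp: nbrs_def insert_commute image_iff)
  qed (auto simp: nbrs_def)
  moreover have "inj_on (\<lambda>w. {c, w}) (nbrs c)" by (auto simp: inj_on_def doubleton_eq_iff)
  ultimately have "degree G c = card (nbrs c)" by (simp add: degree_def card_image)
  then show ?thesis
    using nbrs_cone[OF assms] c finV by (simp add: conical_def)
qed

definition clique :: "'a ugraph \<Rightarrow> 'a set \<Rightarrow> bool" where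
  "clique G W \<longleftrightarrow> W \<subseteq> uverts G \<and> (\<forall>x\<in>W. \<forall>y\<in>W. x \<noteq> y \<longrightarrow> {x, y} \<in> uedges G)"

text \<open>The copy created by the new edge uses that edge, which lies in the image of a clique of size \<open>s\<close>.\<close>

lemma common_clique_if_saturated:
  assumes P: "simple_graph P"
    and cl: "\<And>e. e \<in> uedges P \<Longrightarrow> \<exists>W. e \<subseteq> W \<and> clique P W \<and> card W = s"
    and G: "saturated P G" and uw: "u \<in> uverts G" "w \<in> uverts G" "u \<noteq> w" "{u, w} \<notin> uedges G"
  shows "\<exists>Q. card Q = s - 2 \<and>
    (\<forall>q\<in>Q. {u, q} \<in> uedges G \<and> {w, q} \<in> uedges G \<and> (\<forall>q'\<in>Q. q \<noteq> q' \<longrightarrow> {q, q'} \<in> uedges G))"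
proof -
  have "{u, w} \<in> nonedges G" using uw by (simp add: nonedges_def)
  then have "contains_copy (add_edge G {u, w}) P" using G by (simp add: saturated_def)
  then obtain f where f: "embeds f P (add_edge G {u, w})"
    using contains_copy_iff_embeds[OF P] by blast
  have "\<not> embeds f P G"
    using G contains_copy_iff_embeds[OF P] unfolding saturated_def by blast
  then obtain e where e: "e \<in> uedges P" "f ` e = {u, w}"
    using f by (auto simp: embeds_def add_edge_def)
  then obtain W where W: "e \<subseteq> W" "clique P W" "card W = s" using cl by blast
  have inj: "inj_on f W"
    using f W by (auto simp: embeds_def clique_def intro: inj_on_subset)
  have cW: "card (f ` W) = s" using inj W by (simp add: card_image)
  have sub: "{u, w} \<subseteq> f ` W" using image_mono[OF W(1), of f] e(2) by simp
  have adj: "{x, y} \<in> insert {u, w} (uedges G)" if xy: "x \<in> f ` W" "y \<in> f ` W" "x \<noteq> y" for x y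
  proof -
    obtain a b where ab: "a \<in> W" "b \<in> W" "x = f a" "y = f b" using xy by blast
    then have "{a, b} \<in> uedges P" using W xy by (auto simp: clique_def)
    then have "f ` {a, b} \<in> uedges (add_edge G {u, w})" using f unfolding embeds_def by blast
    then show ?thesis using ab by (simp add: add_edge_def)
  qed
  have "card (f ` W - {u, w}) = s - 2" using cW sub uw(3) by (subst card_Diff_subset) auto
  moreover have "{x, q} \<in> uedges G" if "q \<in> f ` W - {u, w}" "x \<in> f ` W" "x \<noteq> q" for x q
    using adj[of x q] that by (auto simp: doubleton_eq_iff)
  ultimately show ?thesis
    using sub by (intro exI[of _ "f ` W - {u, w}"]) (auto simp del: image_insert)
qed

lemma cone_if_saturated:
  assumes P: "simple_graph P"
    and cl: "\<And>e. e \<in> uedges P \<Longrightarrow> \<exists>W. e \<subseteq> W \<and> clique P W \<and> card W = t + 1"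
    and G: "saturated P G" and t: "2 \<le> t" and n: "cone_threshold t \<le> card (uverts G)"
    and sparse: "card (uedges G) + (Suc t choose 2) + 2 < t * card (uverts G)"
  shows "\<exists>c. cone G c"
proof -
  have simple: "simple_graph G" using G by (simp add: saturated_def)
  interpret fin_graph "uverts G" "uedges G" using simple by (rule fin_graph_of_simple)
  interpret linked_graph "uverts G" "uedges G" t
  proof
    fix u w assume "u \<in> uverts G" "w \<in> uverts G" "u \<noteq> w" "w \<notin> nbrs u"
    then obtain Q where "card Q = t - 1"
      "\<forall>q\<in>Q. {u, q} \<in> uedges G \<and> {w, q} \<in> uedges G \<and> (\<forall>q'\<in>Q. q \<noteq> q' \<longrightarrow> {q, q'} \<in> uedges G)"
      using common_clique_if_saturated[OF P cl G, of u w] by (auto simp: nbrs_def)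
    then show "\<exists>Q\<subseteq>nbrs u \<inter> nbrs w. card Q = t - 1 \<and> (\<forall>x\<in>Q. \<forall>y\<in>Q. x \<noteq> y \<longrightarrow> y \<in> nbrs x)"
      by (intro exI[of _ Q]) (auto simp: nbrs_def)
  qed (rule t)
  show ?thesis using cone_if_few_edges[OF n sparse] by (auto simp: cone_def nbrs_def)
qed

section \<open>Induction on the number of cone vertices\<close>

text \<open>Keeping \<open>complete_graph r\<close> as a parameter of the pattern, instead of joining single vertices
  repeatedly, gives the patterns for all \<open>r\<close> the same vertex type and so permits induction on \<open>r\<close>.\<close>

abbreviation (input) cone_join :: "nat \<Rightarrow> 'a ugraph \<Rightarrow> (nat + 'a) ugraph" where
  "cone_join r F \<equiv> join (complete_graph r) F"

lemma simple_cone_join: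
  assumes "simple_graph F"
  shows "simple_graph (cone_join r F)"
  unfolding simple_graph_def
proof (intro conjI ballI)
  show "finite (uverts (cone_join r F))"
    using assms by (simp add: join_def complete_graph_def simple_graph_def)
  fix e assume e: "e \<in> uedges (cone_join r F)"
  then consider (l) e' where "e = Inl ` e'" "e' \<subseteq> {..<r}" "card e' = 2"
    | (r) e' where "e = Inr ` e'" "e' \<in> uedges F"
    | (m) u v where "e = {Inl u, Inr v}" "u < r" "v \<in> uverts F"
    by (auto simp: join_def complete_graph_def)
  then have "e \<subseteq> uverts (cone_join r F) \<and> card e = 2"
    by cases (use assms in \<open>auto simp: join_def complete_graph_def simple_graph_def card_image\<close>)
  then show "e \<subseteq> uverts (cone_join r F)" "card e = 2" by auto
qed

lemma cone_cone_join:
  fixes F :: "'a ugraph"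
  shows "cone (cone_join (Suc r) F) (Inl r)"
proof -
  have "{Inl r, Inl i :: nat + 'a} \<in> (\<lambda>e. Inl ` e) ` {e. e \<subseteq> {..<Suc r} \<and> card e = 2}" if "i < r" for i
    using that by (intro image_eqI[of _ _ "{r, i}"]) auto
  then show ?thesis by (auto simp: cone_def join_def complete_graph_def less_Suc_eq)
qed

lemma del_vert_cone_join:
  fixes F :: "'a ugraph"
  shows "del_vert (cone_join (Suc r) F) (Inl r) = cone_join r F"
proof (rule prod_eqI)
  show "uverts (del_vert (cone_join (Suc r) F) (Inl r)) = uverts (cone_join r F)"
    by (auto simp: del_vert_def join_def complete_graph_def less_Suc_eq)
next
  let ?K = "\<lambda>r. {e. e \<subseteq> {..<r::nat} \<and> card e = 2}"
  let ?M = "\<lambda>r. {{Inl u, Inr v} |u v. u \<in> {..<r::nat} \<and> v \<in> uverts F}"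
  have "{e \<in> ?K (Suc r). r \<notin> e} = ?K r"
    by (auto simp: less_Suc_eq)
  moreover have "{e \<in> (\<lambda>e. Inl ` e :: (nat + 'a) set) ` A. Inl r \<notin> e} = (\<lambda>e. Inl ` e) ` {e \<in> A. r \<notin> e}"
    for A by auto
  ultimately have K: "{e \<in> (\<lambda>e. Inl ` e :: (nat + 'a) set) ` ?K (Suc r). Inl r \<notin> e} =
      (\<lambda>e. Inl ` e) ` ?K r"
    by (simp only:)
  have F: "{e \<in> (\<lambda>e. Inr ` e :: (nat + 'a) set) ` uedges F. Inl r \<notin> e} = (\<lambda>e. Inr ` e) ` uedges F"
    by auto
  have M: "{e \<in> ?M (Suc r). Inl r \<notin> e} = ?M r"
  proof (intro set_eqI iffI)
    fix e assume "e \<in> {e \<in> ?M (Suc r). Inl r \<notin> e}"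
    then obtain u v where "e = {Inl u, Inr v}" "u < Suc r" "v \<in> uverts F" "Inl r \<notin> e" by auto
    moreover from this have "u < r" by (cases "u = r") auto
    ultimately show "e \<in> ?M r" by blast
  next
    fix e assume "e \<in> ?M r"
    then obtain u v where "e = {Inl u, Inr v}" "u < r" "v \<in> uverts F" by auto
    moreover from this have "u < Suc r" "Inl r \<notin> e" by auto
    ultimately show "e \<in> {e \<in> ?M (Suc r). Inl r \<notin> e}" by blast
  qed
  have "{e \<in> A \<union> B \<union> C. Inl r \<notin> e} =
      {e \<in> A. Inl r \<notin> e} \<union> {e \<in> B. Inl r \<notin> e} \<union> {e \<in> C. Inl r \<notin> e}"
    for A B C :: "(nat + 'a) set set" by blast
  then show "uedges (del_vert (cone_join (Suc r) F) (Inl r)) = uedges (cone_join r F)"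
    unfolding del_vert_def join_def complete_graph_def fst_conv snd_conv by (simp only: K F M)
qed

lemma saturated_cone_join_0:
  assumes "simple_graph F"
  shows "saturated (cone_join 0 F) G \<longleftrightarrow> saturated F G"
proof -
  have "{e. e \<subseteq> {..<0::nat} \<and> card e = 2} = {}" by auto
  then have "cone_join 0 F = map_graph Inr F"
    unfolding join_def complete_graph_def map_graph_def
    by (simp only: fst_conv snd_conv image_empty Un_empty_left Plus_def lessThan_0
        Un_empty_right empty_iff simp_thms Collect_empty_eq) auto
  then have "contains_copy H (cone_join 0 F) \<longleftrightarrow> contains_copy H F" for H :: "'b ugraph"
    using contains_copy_of_map_graph[OF assms, of Inr] by simp
  then show ?thesis by (simp add: saturated_def)
qed

text \<open>As \<open>F\<close> has an edge and no isolated vertices, every edge of the join lies in \<open>K_r\<close> together with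
  some edge of \<open>F\<close>, and that edge extends to a clique of \<open>F\<close>.\<close>

lemma clique_in_cone_join:
  fixes F :: "'a ugraph"
  assumes F: "simple_graph F" "uverts F \<noteq> {}" "\<forall>v\<in>uverts F. degree F v \<noteq> 0"
    and cl: "\<And>e. e \<in> uedges F \<Longrightarrow> \<exists>W. e \<subseteq> W \<and> clique F W \<and> card W = t"
    and e: "e \<in> uedges (cone_join r F)"
  shows "\<exists>W. e \<subseteq> W \<and> clique (cone_join r F) W \<and> card W = r + t"
proof -
  have edge: "\<exists>e\<in>uedges F. v \<in> e" if "v \<in> uverts F" for v
  proof (rule ccontr)
    assume "\<not> ?thesis"
    then have "{e \<in> uedges F. v \<in> e} = {}" by blast
    then have "degree F v = 0" unfolding degree_def by (simp only: card.empty)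
    then show False using F(3) that by blast
  qed
  obtain e' where e': "e' \<in> uedges F" "e \<subseteq> Inl ` {..<r} \<union> Inr ` e'"
  proof -
    from e consider (l) d where "e = Inl ` d" "d \<subseteq> {..<r}"
      | (r) d where "e = Inr ` d" "d \<in> uedges F"
      | (m) u v where "e = {Inl u, Inr v}" "u < r" "v \<in> uverts F"
      by (auto simp: join_def complete_graph_def)
    then show thesis
    proof cases
      case l
      then show thesis using that edge F(2) by blast
    next
      case r
      then show thesis using that by blast
    next
      case m
      then show thesis using that edge[of v] by blast
    qed
  qed
  from cl[OF e'(1)] obtain W where W: "e' \<subseteq> W" "clique F W" "card W = t" by blast
  have "finite W" using W F(1) by (auto simp: clique_def simple_graph_def intro: finite_subset)
  then have "card (Inl ` {..<r} \<union> Inr ` W) = r + t"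
    using W by (subst card_Un_disjoint) (auto simp: card_image)
  moreover have "clique (cone_join r F) (Inl ` {..<r} \<union> Inr ` W)"
  proof -
    have ll: "{Inl i, Inl j :: nat + 'a} \<in> (\<lambda>e. Inl ` e) ` {e. e \<subseteq> {..<r} \<and> card e = 2}"
      if "i < r" "j < r" "i \<noteq> j" for i j
      using that by (intro image_eqI[of _ _ "{i, j}"]) auto
    have rr: "{Inr i, Inr j :: nat + 'a} \<in> (\<lambda>e. Inr ` e) ` uedges F" if "i \<in> W" "j \<in> W" "i \<noteq> j" for i j
      using that W by (intro image_eqI[of _ _ "{i, j}"]) (auto simp: clique_def)
    have lr: "{Inl i, Inr j} \<in> uedges (cone_join r F)" if "i < r" "j \<in> W" for i j
      using that W by (auto simp: clique_def join_def complete_graph_def)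
    have "{x, y} \<in> uedges (cone_join r F)"
      if "x \<in> Inl ` {..<r} \<union> Inr ` W" "y \<in> Inl ` {..<r} \<union> Inr ` W" "x \<noteq> y" for x y
    proof (cases x; cases y)
      fix i j assume "x = Inl i" "y = Inl j"
      then show ?thesis using ll[of i j] that by (auto simp: join_def complete_graph_def)
    next
      fix i j assume "x = Inl i" "y = Inr j"
      then show ?thesis using lr[of i j] that by auto
    next
      fix i j assume "x = Inr i" "y = Inl j"
      then show ?thesis using lr[of j i] that by (auto simp: insert_commute)
    next
      fix i j assume "x = Inr i" "y = Inr j"
      then show ?thesis using rr[of i j] that by (auto simp: join_def)
    qed
    moreover have "Inl ` {..<r} \<union> Inr ` W \<subseteq> uverts (cone_join r F)"
      using W by (auto simp: clique_def join_def complete_graph_def)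
    ultimately show ?thesis unfolding clique_def by blast
  qed
  moreover have "e \<subseteq> Inl ` {..<r} \<union> Inr ` W" using e'(2) W(1) by blast
  ultimately show ?thesis by blast
qed

locale clique_covered =
  fixes F :: "'a ugraph" and t :: nat
  assumes simpleF: "simple_graph F" and nonempty: "uverts F \<noteq> {}"
    and no_isolated: "\<forall>v\<in>uverts F. degree F v \<noteq> 0"
    and covered: "e \<in> uedges F \<Longrightarrow> \<exists>W. e \<subseteq> W \<and> clique F W \<and> card W = t"
    and t2: "2 \<le> t"
begin

lemma zero_choose_2: "0 choose 2 = (0::nat)"
  by (simp add: numeral_2_eq_2)

lemma has_edge: "uedges F \<noteq> {}"
  using nonempty no_isolated by (auto simp: degree_def)

text \<open>Deleting a cone vertex from a graph on \<open>n\<close> vertices removes \<open>n - 1\<close> edges, and the bound on the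
  number of edges decreases by exactly as much when \<open>r\<close> and \<open>n\<close> both decrease by one. The hypothesis
  thus survives until no cone is left in the pattern.\<close>

lemma saturated_cone_join_lower:
  "\<exists>N. \<forall>G :: 'b ugraph. saturated (cone_join r F) G \<longrightarrow> N \<le> card (uverts G) \<longrightarrow>
     card (uedges G) + (r + t choose 2) + 2 < (r + t - 1) * card (uverts G) \<longrightarrow>
     r \<le> card {c. cone G c} \<and>
     r * (card (uverts G) - r) + sat (card (uverts G) - r) F + (r choose 2) \<le> card (uedges G)"
proof (induction r)
  case 0
  have "sat (card (uverts G)) F \<le> card (uedges G)" if "saturated (cone_join 0 F) G"
    for G :: "'b ugraph"
    using sat_le[OF _ simpleF] saturated_cone_join_0[OF simpleF] that by blast
  then show ?case by (auto simp: zero_choose_2)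
next
  case (Suc r)
  then obtain N where N: "\<And>G :: 'b ugraph. \<lbrakk>saturated (cone_join r F) G; N \<le> card (uverts G);
     card (uedges G) + (r + t choose 2) + 2 < (r + t - 1) * card (uverts G)\<rbrakk> \<Longrightarrow>
     r \<le> card {c. cone G c} \<and>
     r * (card (uverts G) - r) + sat (card (uverts G) - r) F + (r choose 2) \<le> card (uedges G)"
    by blast
  let ?P = "cone_join (Suc r) F"
  show ?case
  proof (intro exI[of _ "N + 1 + r + cone_threshold (r + t)"] allI impI)
    fix G :: "'b ugraph"
    assume G: "saturated ?P G"
      and n: "N + 1 + r + cone_threshold (r + t) \<le> card (uverts G)"
      and sparse: "card (uedges G) + (Suc r + t choose 2) + 2 < (Suc r + t - 1) * card (uverts G)"
    have simple: "simple_graph G" using G by (simp add: saturated_def)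
    have P: "simple_graph ?P" using simpleF by (rule simple_cone_join)
    have cl: "\<exists>W. e \<subseteq> W \<and> clique ?P W \<and> card W = (r + t) + 1" if "e \<in> uedges ?P" for e
      using clique_in_cone_join[OF simpleF nonempty no_isolated covered that] by simp
    obtain c where c: "cone G c"
      using cone_if_saturated[OF P cl G] t2 n sparse by auto
    define G' where "G' = del_vert G c"
    define n' where "n' = card (uverts G')"
    have simple': "simple_graph G'" using simple by (simp add: G'_def simple_del_vert)
    have cV: "c \<in> uverts G" using c by (simp add: cone_def)
    have n': "card (uverts G) = n' + 1"
      using card.remove[OF _ cV] simple by (simp add: n'_def G'_def del_vert_def simple_graph_def)
    have edges: "card (uedges G) = card (uedges G') + n'"
      using card_edges_del_cone[OF simple c] n' by (simp add: G'_def)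
    have sat': "saturated (cone_join r F) G'"
      using saturated_del_cone[OF P cone_cone_join simple c] G
      by (simp add: G'_def del_vert_cone_join)
    have "(Suc r + t choose 2) = (r + t) + (r + t choose 2)" by (simp add: numeral_2_eq_2)
    moreover have "(r + t) * (n' + 1) = (r + t - 1) * n' + n' + (r + t)"
      using t2 by (cases "r + t") (auto simp: algebra_simps)
    ultimately have "card (uedges G') + (r + t choose 2) + 2 < (r + t - 1) * card (uverts G')"
      using sparse n' edges by (simp add: n'_def)
    from N[OF sat' _ this] have IH: "r \<le> card {c. cone G' c}"
      "r * (n' - r) + sat (n' - r) F + (r choose 2) \<le> card (uedges G')"
      using n n' by (auto simp: n'_def)
    have "insert c {b. cone G' b} \<subseteq> {b. cone G b}"
      using c by (auto simp: cone_def G'_def del_vert_def insert_commute)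
    moreover have "finite {b. cone G b}"
      using simple by (auto simp: cone_def simple_graph_def intro: finite_subset[of _ "uverts G"])
    ultimately have "card (insert c {b. cone G' b}) \<le> card {b. cone G b}" by (intro card_mono)
    moreover have "c \<notin> {b. cone G' b}" by (simp add: cone_def G'_def del_vert_def)
    moreover have "finite {b. cone G' b}"
      using simple' by (auto simp: cone_def simple_graph_def intro: finite_subset[of _ "uverts G'"])
    ultimately have "Suc r \<le> card {b. cone G b}" using IH(1) by simp
    moreover have "Suc r * (n' - r) + sat (n' - r) F + (Suc r choose 2) \<le> card (uedges G)"
    proof -
      have "r \<le> n'" using n n' by simp
      then show ?thesis using IH(2) edges by (simp add: numeral_2_eq_2)
    qed
    ultimately show "Suc r \<le> card {c. cone G c} \<and>
      Suc r * (card (uverts G) - Suc r) + sat (card (uverts G) - Suc r) F + (Suc r choose 2)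
        \<le> card (uedges G)"
      using n' by simp
  qed
qed

text \<open>Join \<open>r\<close> cone vertices to a smallest \<open>F\<close>-saturated graph.\<close>

lemma ex_saturated_cone_join:
  "\<exists>G :: nat ugraph. saturated (cone_join r F) G \<and> card (uverts G) = n + r \<and>
     card (uedges G) = r * n + sat n F + (r choose 2)"
proof (induction r)
  case 0
  show ?case
    using sat_attained[OF simpleF has_edge, of n] saturated_cone_join_0[OF simpleF]
    by (metis add_0_right add_0 mult_0 zero_choose_2)
next
  case (Suc r)
  then obtain G :: "nat ugraph" where G: "saturated (cone_join r F) G" "card (uverts G) = n + r"
     "card (uedges G) = r * n + sat n F + (r choose 2)" by blast
  have simple: "simple_graph G" using G by (simp add: saturated_def)
  then have fin: "finite (uverts G)" by (simp add: simple_graph_def)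
  then obtain c where c: "c \<notin> uverts G" using ex_new_if_finite infinite_UNIV_nat by blast
  define G' where "G' = (insert c (uverts G), uedges G \<union> (\<lambda>w. {c, w}) ` uverts G)"
  have simple': "simple_graph G'" using simple c by (auto simp: simple_graph_def G'_def card_insert_if)
  have cone': "cone G' c" by (auto simp: cone_def G'_def)
  have "c \<notin> e" if "e \<in> uedges G" for e using that simple c by (auto simp: simple_graph_def)
  then have del: "del_vert G' c = G" using c by (auto simp: del_vert_def G'_def intro!: prod_eqI)
  have "saturated (cone_join (Suc r) F) G'"
    using saturated_del_cone[OF simple_cone_join[OF simpleF] cone_cone_join simple' cone']
      G(1) del by (simp add: del_vert_cone_join)
  moreover have "card (uverts G') = n + Suc r" using c fin G by (simp add: G'_def)
  moreover from this have "card (uedges G') = Suc r * n + sat n F + (Suc r choose 2)"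
    using card_edges_del_cone[OF simple' cone'] del G(3) by (simp add: numeral_2_eq_2)
  ultimately show ?case by blast
qed

text \<open>When \<open>r\<close> increases by one, both sides grow by \<open>n + 2 * r + t\<close>.\<close>

lemma bound_step:
  assumes "s + (t choose 2) + 2 < (t - 1) * n"
  shows "r * n + s + (r choose 2) + (r + t choose 2) + 2 < (r + t - 1) * (n + r)"
proof (induction r)
  case 0
  then show ?case using assms by (simp add: zero_choose_2)
next
  case (Suc r)
  have "(Suc r + t choose 2) = (r + t) + (r + t choose 2)" "(Suc r choose 2) = r + (r choose 2)"
    by (simp_all add: numeral_2_eq_2)
  moreover have "(Suc r + t - 1) * (n + Suc r) = (r + t - 1) * (n + r) + (n + r) + (r + t)"
    using t2 by (cases "r + t") (auto simp: algebra_simps)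
  ultimately show ?case using Suc by simp
qed

lemma sat_cone_join_bounds:
  assumes "sat n F + (t choose 2) + 2 < (t - 1) * n"
  shows "sat (n + r) (cone_join r F) \<le> r * n + sat n F + (r choose 2)"
    and "sat (n + r) (cone_join r F) + (r + t choose 2) + 2 < (r + t - 1) * (n + r)"
proof -
  obtain G :: "nat ugraph" where "saturated (cone_join r F) G" "card (uverts G) = n + r"
     "card (uedges G) = r * n + sat n F + (r choose 2)" using ex_saturated_cone_join by blast
  then show le: "sat (n + r) (cone_join r F) \<le> r * n + sat n F + (r choose 2)"
    using sat_le[OF _ simple_cone_join[OF simpleF]] by metis
  show "sat (n + r) (cone_join r F) + (r + t choose 2) + 2 < (r + t - 1) * (n + r)"
    using le bound_step[OF assms, of r] by simp
qed

end

theorem theorem1p9: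
  fixes r t :: nat and F :: "'a ugraph"
  assumes "r \<ge> 1" and "t \<ge> 2"
    and "simple_graph F" and "uverts F \<noteq> {}"
    and "\<forall>v\<in>uverts F. degree F v \<noteq> 0"
    and "\<forall>e\<in>uedges F. \<exists>H. copy_in H (complete_graph t) F \<and> e \<in> uedges H"
    and "\<forall>\<^sub>F n in sequentially.
           int (sat n F) < (int t - 1) * int n - int (t choose 2) - 2"
  shows "(\<forall>\<^sub>F n in sequentially.
            sat n (join (complete_graph r) F) = r * (n - r) + sat (n - r) F + (r choose 2)) \<and>
         (\<forall>\<^sub>F n in sequentially. \<forall>G :: 'b ugraph.
            extremal n (join (complete_graph r) F) G \<longrightarrow>
            card {v \<in> uverts G. conical G v} \<ge> r)"
proof -
  interpret clique_covered F t
  proof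
    fix e assume "e \<in> uedges F"
    then obtain H f where H: "subgraph H F" "e \<in> uedges H"
      and f: "bij_betw f {..<t} (uverts H)"
        "uedges H = (\<lambda>e. f ` e) ` {e. e \<subseteq> {..<t} \<and> card e = 2}"
      using assms(6) by (fastforce simp: copy_in_def isomorphic_def complete_graph_def)
    have "{x, y} \<in> uedges H" if xy: "x \<in> uverts H" "y \<in> uverts H" "x \<noteq> y" for x y
    proof -
      obtain i j where "i < t" "j < t" "x = f i" "y = f j"
        using xy bij_betw_imp_surj_on[OF f(1)] by blast
      then show ?thesis
        using xy(3) unfolding f(2) by (intro image_eqI[of _ _ "{i, j}"]) (auto simp: card_insert_if)
    qed
    then have "clique F (uverts H)" using H by (auto simp: clique_def subgraph_def)
    moreover have "e \<subseteq> uverts H" using H by (auto simp: subgraph_def simple_graph_def)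
    moreover have "card (uverts H) = t" using bij_betw_same_card[OF f(1)] by simp
    ultimately show "\<exists>W. e \<subseteq> W \<and> clique F W \<and> card W = t" by blast
  qed (use assms in auto)
  let ?P = "cone_join r F"
  obtain N0 where N0: "\<And>n. N0 \<le> n \<Longrightarrow>
      int (sat n F) < (int t - 1) * int n - int (t choose 2) - 2"
    using assms(7) unfolding eventually_sequentially by blast
  have small: "sat n F + (t choose 2) + 2 < (t - 1) * n" if "N0 \<le> n" for n
  proof -
    have "(int t - 1) * int n = int ((t - 1) * n)" using assms(2) by (simp add: of_nat_diff)
    then have "int (sat n F + (t choose 2) + 2) < int ((t - 1) * n)" using N0[OF that] by linarith
    then show ?thesis by (simp only: of_nat_less_iff)
  qed
  have upper: "sat n ?P \<le> r * (n - r) + sat (n - r) F + (r choose 2)"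
      "sat n ?P + (r + t choose 2) + 2 < (r + t - 1) * n" if "N0 + r \<le> n" for n
    using sat_cone_join_bounds[OF small, of "n - r" r] that by auto
  have "\<forall>\<^sub>F n in sequentially. sat n ?P = r * (n - r) + sat (n - r) F + (r choose 2)"
  proof -
    obtain N where N: "\<And>G :: nat ugraph. \<lbrakk>saturated ?P G; N \<le> card (uverts G);
     card (uedges G) + (r + t choose 2) + 2 < (r + t - 1) * card (uverts G)\<rbrakk> \<Longrightarrow>
     r * (card (uverts G) - r) + sat (card (uverts G) - r) F + (r choose 2) \<le> card (uedges G)"
      using saturated_cone_join_lower[of r] by blast
    have "sat n ?P = r * (n - r) + sat (n - r) F + (r choose 2)" if n: "N + N0 + r \<le> n" for n
    proof -
      have "uedges ?P \<noteq> {}" using has_edge by (simp add: join_def)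
      then obtain G :: "nat ugraph" where
        "saturated ?P G" "card (uverts G) = n" "card (uedges G) = sat n ?P"
        using sat_attained[OF simple_cone_join[OF simpleF]] by metis
      then show ?thesis using N[of G] upper[of n] n by auto
    qed
    then show ?thesis unfolding eventually_sequentially by blast
  qed
  moreover have "\<forall>\<^sub>F n in sequentially. \<forall>G :: 'b ugraph.
            extremal n ?P G \<longrightarrow> card {v \<in> uverts G. conical G v} \<ge> r"
  proof -
    obtain N where N: "\<And>G :: 'b ugraph. \<lbrakk>saturated ?P G; N \<le> card (uverts G);
     card (uedges G) + (r + t choose 2) + 2 < (r + t - 1) * card (uverts G)\<rbrakk> \<Longrightarrow>
     r \<le> card {c. cone G c}"
      using saturated_cone_join_lower[of r] by blast
    have "card {v \<in> uverts G. conical G v} \<ge> r"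
      if n: "N + N0 + r \<le> n" and G: "extremal n ?P G" for n and G :: "'b ugraph"
    proof -
      have simple: "simple_graph G" using G by (simp add: extremal_def saturated_def)
      have "r \<le> card {c. cone G c}" using N[of G] upper(2)[of n] n G by (auto simp: extremal_def)
      also have "\<dots> \<le> card {v \<in> uverts G. conical G v}"
        using simple conical_if_cone[OF simple]
        by (intro card_mono) (auto simp: simple_graph_def cone_def)
      finally show ?thesis .
    qed
    then show ?thesis unfolding eventually_sequentially by blast
  qed
  ultimately show ?thesis ..
qed

end
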